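(* (i) For each odd integer $D\geq 1$, every $(D,\mathrm{F})_e$-critical multigraph $G$ with $|V(G)|\geq 3$ satisfies $|E(G)|\geq \frac{(4D+3)|V(G)|+2}{2(D+1)}$. (ii) For each even integer $D\geq 2$, every $(D,\mathrm{F})_e$-critical multigraph $G$ with $|V(G)|\geq 3$ satisfies $|E(G)|\geq \frac{(4D+1)|V(G)|+2}{2D+1}$.
   Context: All multigraphs are loopless; edges are counted with multiplicity. A forest is an acyclic multigraph, where a pair of parallel edges counts as a cycle. A $(D,\mathrm{F})_e$-coloring of a multigraph $G$ is a partition $(M,F)$ of $V(G)$ such that $G[M]$ is a forest each of whose connected components has at most $D$ edges and $G[F]$ is a forest. A multigraph is $(D,\mathrm{F})_e$-critical if it has no $(D,\mathrm{F})_e$-coloring but every proper subgraph of it has one. *)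

theory Defs
  imports Complex_Main "HOL-Library.Multiset"
begin

text \<open>
  An undirected loopless multigraph is a finite vertex set with a multiset of two-element
  vertex sets; the multiplicity of an edge is its count in the multiset.
\<close>

record 'a mgraph =
  verts :: "'a set"
  edges :: "'a set multiset"

definition multigraph :: "'a mgraph \<Rightarrow> bool" where
  "multigraph G \<longleftrightarrow>
     finite (verts G) \<and> (\<forall>e \<in># edges G. e \<subseteq> verts G \<and> card e = 2)"

definition subgraph :: "'a mgraph \<Rightarrow> 'a mgraph \<Rightarrow> bool" where
  "subgraph H G \<longleftrightarrow>
     multigraph H \<and> verts H \<subseteq> verts G \<and> edges H \<subseteq># edges G"

definition proper_subgraph :: "'a mgraph \<Rightarrow> 'a mgraph \<Rightarrow> bool" where
  "proper_subgraph H G \<longleftrightarrow> subgraph H G \<and> H \<noteq> G"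

definition induced :: "'a mgraph \<Rightarrow> 'a set \<Rightarrow> 'a mgraph" where
  "induced G S = \<lparr>verts = verts G \<inter> S, edges = {#e \<in># edges G. e \<subseteq> S#}\<rparr>"

text \<open>
  A cycle is given by its cyclic sequence of distinct vertices. Its consecutive edges are
  collected as a multiset, so a cycle of length two needs an edge of multiplicity at least two.
\<close>

definition is_cycle :: "'a mgraph \<Rightarrow> 'a list \<Rightarrow> bool" where
  "is_cycle G vs \<longleftrightarrow>
     2 \<le> length vs \<and> distinct vs \<and> set vs \<subseteq> verts G \<and>
     mset (map (\<lambda>i. {vs ! i, vs ! (Suc i mod length vs)}) [0..<length vs]) \<subseteq># edges G"

definition forest :: "'a mgraph \<Rightarrow> bool" where
  "forest G \<longleftrightarrow> multigraph G \<and> (\<nexists>vs. is_cycle G vs)"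

definition adjacency :: "'a mgraph \<Rightarrow> ('a \<times> 'a) set" where
  "adjacency G = {(u, v). {u, v} \<in># edges G}"

definition components :: "'a mgraph \<Rightarrow> 'a mgraph set" where
  "components G = {induced G {u. (v, u) \<in> (adjacency G)\<^sup>*} | v. v \<in> verts G}"

definition DF_coloring :: "nat \<Rightarrow> 'a mgraph \<Rightarrow> 'a set \<Rightarrow> 'a set \<Rightarrow> bool" where
  "DF_coloring D G M F \<longleftrightarrow>
     M \<union> F = verts G \<and> M \<inter> F = {} \<and>
     forest (induced G M) \<and> (\<forall>C \<in> components (induced G M). size (edges C) \<le> D) \<and>
     forest (induced G F)"

definition DF_colorable :: "nat \<Rightarrow> 'a mgraph \<Rightarrow> bool" where
  "DF_colorable D G \<longleftrightarrow> (\<exists>M F. DF_coloring D G M F)"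

definition DF_critical :: "nat \<Rightarrow> 'a mgraph \<Rightarrow> bool" where
  "DF_critical D G \<longleftrightarrow>
     multigraph G \<and> \<not> DF_colorable D G \<and>
     (\<forall>H. proper_subgraph H G \<longrightarrow> DF_colorable D H)"

end

theory Submission
  imports Defs
begin

text \<open>
  The proof uses the potential method. Give every vertex a weight, which stands for edges
  already attached to it should it go to M, and let a vertex of weight n have potential \<open>a n\<close>,
  falling from \<open>2k - 1\<close> at weight 0 to \<open>k - 1\<close> at the weights above D that force the vertex into F;
  an edge costs \<open>k\<close>. Here \<open>k = 2D + 2\<close> for odd D and \<open>k = 2D + 1\<close> for even D. The claim is that a
  graph all of whose vertex sets have potential at least \<open>-1\<close> is colourable.

  In a smallest counterexample every proper vertex set with at least two vertices has potential at
  least \<open>k\<close>: otherwise colour a set of least potential and contract its F-part to one vertex of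
  weight above D, while the neighbours of its M-part are raised above D,
  one of them slightly less. This gap pays for deleting
  vertices of degree three and raising the weights of their neighbours. If D is even, every
  remaining vertex contributes a negative amount when edges are split evenly between their ends. If D is
  odd, only the vertices of degree three and weight \<open>(D - 1) / 2\<close> contribute a positive amount,
  and they are so sparse that discharging finishes the proof.
\<close>

section \<open>Multigraphs as multiplicity functions\<close>

text \<open>The threshold \<open>-1\<close> is forced: two vertices of weight above D joined by a
  double edge cannot be coloured and have potential \<open>2(k-1) - 2k = -2\<close>. The drop from
  weight 0 to weight \<open>D + 1\<close> is exactly \<open>k\<close>, the price of an edge, so an
  edge cut at the boundary of a contracted set pays for forcing its outer end into F. The obstacle
  is the whole vertex set. If S has least potential r < k among proper sets, larger proper sets do
  not lie below r, but V may have potential \<open>-1\<close>. Hence one boundary edge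
  \<open>s0 x0\<close> needs a cheaper treatment: \<open>s0\<close> is raised by j before S is
  coloured, at cost at most \<open>r + 1\<close>, and \<open>x0\<close> by \<open>D + 1 - j\<close>,
  at cost at most \<open>k - r\<close>. With steps of 2 the two raises cost up to
  \<open>2(D + 1)\<close>, and \<open>k + 1\<close> is available. For \<open>k = 2D + 2\<close> one
  unit is spare, whatever the parity of r. For \<open>k = 2D + 1\<close> nothing is spare, and an
  even r works only because one step costs 1.\<close>

definition mult_fun :: "('a \<Rightarrow> 'a \<Rightarrow> nat) \<Rightarrow> bool" where
  "mult_fun m \<longleftrightarrow> (\<forall>x y. m x y = m y x) \<and> (\<forall>x. m x x = 0)"

definition degree :: "('a \<Rightarrow> 'a \<Rightarrow> nat) \<Rightarrow> 'a \<Rightarrow> 'a set \<Rightarrow> nat" where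
  "degree m v A = (\<Sum>y\<in>A. m v y)"

text \<open>No rounding occurs for symmetric \<open>m\<close> with zero diagonal on a finite set, by
  \<open>handshake\<close>.\<close>

definition edge_count :: "('a \<Rightarrow> 'a \<Rightarrow> nat) \<Rightarrow> 'a set \<Rightarrow> nat" where
  "edge_count m A = (\<Sum>x\<in>A. degree m x A) div 2"

lemma degree_empty [simp]: "degree m v {} = 0"
  by (simp add: degree_def)

lemma degree_insert: "finite A \<Longrightarrow> x \<notin> A \<Longrightarrow> degree m v (insert x A) = m v x + degree m v A"
  by (simp add: degree_def)

lemma degree_Un: "finite A \<Longrightarrow> finite B \<Longrightarrow> A \<inter> B = {} \<Longrightarrow> degree m v (A \<union> B) = degree m v A + degree m v B"
  by (simp add: degree_def sum.union_disjoint)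

lemma degree_mono: "finite B \<Longrightarrow> A \<subseteq> B \<Longrightarrow> degree m v A \<le> degree m v B"
  unfolding degree_def by (rule sum_mono2) auto

lemma degree_remove: "finite A \<Longrightarrow> x \<in> A \<Longrightarrow> degree m v A = m v x + degree m v (A - {x})"
  by (simp add: degree_def sum.remove)

lemma degree_ge: "finite A \<Longrightarrow> x \<in> A \<Longrightarrow> m v x \<le> degree m v A"
  by (simp add: degree_remove)

lemma degree_pos: "0 < degree m v A \<Longrightarrow> \<exists>y\<in>A. 0 < m v y"
  unfolding degree_def by (auto simp: sum_nonneg_eq_0_iff intro: ccontr)

lemma degree_self: "mult_fun m \<Longrightarrow> finite A \<Longrightarrow> degree m v (insert v A) = degree m v A"
  by (cases "v \<in> A") (auto simp: degree_insert insert_absorb mult_fun_def)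

lemma degree_sum_swap: "mult_fun m \<Longrightarrow> (\<Sum>x\<in>A. degree m x B) = (\<Sum>y\<in>B. degree m y A)"
  unfolding degree_def mult_fun_def by (subst sum.swap) simp

lemma sum_degree_insert:
  assumes "mult_fun m" "finite A" "v \<notin> A"
  shows "(\<Sum>x\<in>insert v A. degree m x (insert v A)) = (\<Sum>x\<in>A. degree m x A) + 2 * degree m v A"
proof -
  have "(\<Sum>x\<in>A. degree m x (insert v A)) = (\<Sum>x\<in>A. m x v) + (\<Sum>x\<in>A. degree m x A)"
    using assms by (simp add: degree_insert sum.distrib)
  moreover have "(\<Sum>x\<in>A. m x v) = degree m v A"
    using assms(1) by (simp add: degree_def mult_fun_def)
  ultimately show ?thesis
    using assms by (simp add: degree_self)
qed

lemma handshake: "mult_fun m \<Longrightarrow> finite A \<Longrightarrow> (\<Sum>x\<in>A. degree m x A) = 2 * edge_count m A"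
proof -
  assume m: "mult_fun m" and "finite A"
  from this(2) have "even (\<Sum>x\<in>A. degree m x A)"
    by induction (simp_all add: sum_degree_insert[OF m] del: sum.insert)
  then show ?thesis by (simp add: edge_count_def)
qed

lemma edge_count_empty [simp]: "edge_count m {} = 0"
  by (simp add: edge_count_def)

lemma edge_count_insert:
  assumes "mult_fun m" "finite A" "v \<notin> A"
  shows "edge_count m (insert v A) = edge_count m A + degree m v A"
  using sum_degree_insert[OF assms] handshake[OF assms(1,2)] handshake[OF assms(1), of "insert v A"] assms(2)
  by simp

lemma edge_count_Un:
  assumes "mult_fun m" "finite A" "finite B" "A \<inter> B = {}"
  shows "edge_count m (A \<union> B) = edge_count m A + edge_count m B + (\<Sum>x\<in>A. degree m x B)"
  using assms(2,4)
proof induction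
  case (insert v A)
  have "edge_count m (insert v (A \<union> B)) = edge_count m (A \<union> B) + degree m v (A \<union> B)"
    using insert.hyps insert.prems assms by (intro edge_count_insert) auto
  moreover have "degree m v (A \<union> B) = degree m v A + degree m v B"
    using insert assms by (intro degree_Un) auto
  ultimately show ?case
    using insert assms by (simp add: edge_count_insert)
qed simp

lemma edge_count_cong: "(\<And>x y. x \<in> A \<Longrightarrow> y \<in> A \<Longrightarrow> m x y = m' x y) \<Longrightarrow> edge_count m A = edge_count m' A"
  unfolding edge_count_def degree_def by (simp cong: sum.cong)

lemma edge_count_mono_fun: "(\<And>x y. m x y \<le> m' x y) \<Longrightarrow> edge_count m A \<le> edge_count m' A"
  unfolding edge_count_def degree_def by (intro div_le_mono sum_mono) auto

lemma edge_count_mono: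
  assumes "mult_fun m" "finite B" "A \<subseteq> B"
  shows "edge_count m A \<le> edge_count m B"
proof -
  have "edge_count m (A \<union> (B - A)) = edge_count m A + edge_count m (B - A) + (\<Sum>x\<in>A. degree m x (B - A))"
    using assms finite_subset by (intro edge_count_Un) auto
  moreover have "A \<union> (B - A) = B" using assms by auto
  ultimately show ?thesis by simp
qed

lemma edge_count_singleton [simp]: "mult_fun m \<Longrightarrow> edge_count m {v} = 0"
  using edge_count_insert[of m "{}" v] by simp

definition add_edge :: "'a \<Rightarrow> 'a \<Rightarrow> ('a \<Rightarrow> 'a \<Rightarrow> nat) \<Rightarrow> 'a \<Rightarrow> 'a \<Rightarrow> nat" where
  "add_edge x y m = (\<lambda>u v. m u v + (if {u, v} = {x, y} then 1 else 0))"

lemma mult_fun_add_edge: "mult_fun m \<Longrightarrow> x \<noteq> y \<Longrightarrow> mult_fun (add_edge x y m)"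
  unfolding mult_fun_def add_edge_def by (auto simp: doubleton_eq_iff insert_commute)

lemma degree_add_edge:
  assumes "finite A" "x \<noteq> y"
  shows "degree (add_edge x y m) v A =
    degree m v A + (if v = x \<and> y \<in> A then 1 else 0) + (if v = y \<and> x \<in> A then 1 else 0)"
proof -
  have "degree (add_edge x y m) v A = degree m v A + (\<Sum>u\<in>A. if {v, u} = {x, y} then 1 else 0)"
    by (simp add: degree_def add_edge_def sum.distrib)
  also have "(\<Sum>u\<in>A. if {v, u} = {x, y} then 1 else 0) =
     (\<Sum>u\<in>A. (if v = x \<and> u = y then 1 else 0) + (if v = y \<and> u = x then 1 else (0::nat)))"
    using assms(2) by (intro sum.cong) (auto simp: doubleton_eq_iff)
  also have "\<dots> = (if v = x \<and> y \<in> A then 1 else 0) + (if v = y \<and> x \<in> A then 1 else 0)"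
    using assms(1) by (cases "v = x"; cases "v = y") (simp_all add: sum.distrib)
  finally show ?thesis by simp
qed

lemma edge_count_add_edge:
  assumes "mult_fun m" "finite A" "x \<noteq> y"
  shows "edge_count (add_edge x y m) A = edge_count m A + (if x \<in> A \<and> y \<in> A then 1 else 0)"
  using assms(2)
proof induction
  case (insert v A)
  then show ?case
    using assms by (auto simp: edge_count_insert mult_fun_add_edge degree_add_edge)
qed simp

section \<open>Weighted colourings\<close>

text \<open>Being acyclic and the bound on components are expressed by counting. In a forest the connected
  vertex sets \<open>B\<close> are those that span exactly \<open>card B - 1\<close> edges.\<close>

definition acyclic_on :: "('a \<Rightarrow> 'a \<Rightarrow> nat) \<Rightarrow> 'a set \<Rightarrow> bool" where
  "acyclic_on m F \<longleftrightarrow> (\<forall>B\<subseteq>F. B \<noteq> {} \<longrightarrow> edge_count m B < card B)"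

definition bounded_on :: "nat \<Rightarrow> ('a \<Rightarrow> 'a \<Rightarrow> nat) \<Rightarrow> ('a \<Rightarrow> nat) \<Rightarrow> 'a set \<Rightarrow> bool" where
  "bounded_on D m w M \<longleftrightarrow> (\<forall>B\<subseteq>M. B \<noteq> {} \<longrightarrow>
     edge_count m B < card B \<and> (Suc (edge_count m B) = card B \<longrightarrow> edge_count m B + sum w B \<le> D))"

definition wcolorable :: "nat \<Rightarrow> ('a \<Rightarrow> 'a \<Rightarrow> nat) \<Rightarrow> ('a \<Rightarrow> nat) \<Rightarrow> 'a set \<Rightarrow> bool" where
  "wcolorable D m w V \<longleftrightarrow> (\<exists>M F. M \<union> F = V \<and> M \<inter> F = {} \<and> bounded_on D m w M \<and> acyclic_on m F)"

lemma wcolorableI: "M \<union> F = V \<Longrightarrow> M \<inter> F = {} \<Longrightarrow> bounded_on D m w M \<Longrightarrow> acyclic_on m F \<Longrightarrow> wcolorable D m w V"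
  unfolding wcolorable_def by blast

lemma acyclic_on_empty [simp]: "acyclic_on m {}" and bounded_on_empty [simp]: "bounded_on D m w {}"
  by (auto simp: acyclic_on_def bounded_on_def)

lemma acyclic_on_D: "acyclic_on m F \<Longrightarrow> B \<subseteq> F \<Longrightarrow> B \<noteq> {} \<Longrightarrow> edge_count m B < card B"
  by (auto simp: acyclic_on_def)

lemma bounded_on_D:
  assumes "bounded_on D m w M" "B \<subseteq> M" "B \<noteq> {}"
  shows "edge_count m B < card B" "Suc (edge_count m B) = card B \<Longrightarrow> edge_count m B + sum w B \<le> D"
  using assms by (auto simp: bounded_on_def)

lemma bounded_on_weight: "mult_fun m \<Longrightarrow> bounded_on D m w M \<Longrightarrow> v \<in> M \<Longrightarrow> w v \<le> D"
  using bounded_on_D(2)[of D m w M "{v}"] by simp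

lemma bounded_on_sing: "mult_fun m \<Longrightarrow> w v \<le> D \<Longrightarrow> bounded_on D m w {v}"
  unfolding bounded_on_def by (auto simp: subset_singleton_iff)

lemma bounded_on_mono_fun:
  assumes "bounded_on D m' w M" "\<And>x y. m x y \<le> m' x y"
  shows "bounded_on D m w M"
  unfolding bounded_on_def
proof (intro allI impI conjI)
  fix B assume B: "B \<subseteq> M" "B \<noteq> {}"
  have le: "edge_count m B \<le> edge_count m' B" using assms(2) by (rule edge_count_mono_fun)
  then show "edge_count m B < card B" using bounded_on_D(1)[OF assms(1) B] by simp
  assume "Suc (edge_count m B) = card B"
  then show "edge_count m B + sum w B \<le> D"
    using bounded_on_D[OF assms(1) B] le by linarith
qed

lemma bounded_on_mono_weight:
  assumes "bounded_on D m w' M" "\<And>x. x \<in> M \<Longrightarrow> w x \<le> w' x"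
  shows "bounded_on D m w M"
  unfolding bounded_on_def
proof (intro allI impI conjI)
  fix B assume B: "B \<subseteq> M" "B \<noteq> {}"
  show "edge_count m B < card B" using bounded_on_D(1)[OF assms(1) B] by simp
  assume "Suc (edge_count m B) = card B"
  moreover have "sum w B \<le> sum w' B" using assms(2) B by (intro sum_mono) auto
  ultimately show "edge_count m B + sum w B \<le> D"
    using bounded_on_D[OF assms(1) B] by linarith
qed

text \<open>A tree meeting both sides must contain the only crossing edge, and its two parts are
  trees. Their bounds add up to \<open>2 * D\<close>; the extra weight \<open>D + 1\<close> that
  \<open>w1\<close> and \<open>w2\<close> together give to the ends of the crossing edge pays for
  one \<open>D\<close> and for the edge itself.\<close>

lemma bounded_on_join:
  assumes m: "mult_fun m" and fin: "finite M1" "finite M2" "M1 \<inter> M2 = {}"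
    and g1: "bounded_on D m w1 M1" and g2: "bounded_on D m w2 M2"
    and w1: "\<And>s. s \<in> M1 \<Longrightarrow> w s \<le> w1 s" and w2: "\<And>x. x \<in> M2 \<Longrightarrow> w x \<le> w2 x"
    and cross: "(\<Sum>x\<in>M2. degree m x M1) \<le> 1"
    and rs: "\<And>s x. s \<in> M1 \<Longrightarrow> x \<in> M2 \<Longrightarrow> 0 < m x s \<Longrightarrow> w x + w s + D + 1 \<le> w2 x + w1 s"
  shows "bounded_on D m w (M1 \<union> M2)"
  unfolding bounded_on_def
proof (intro allI impI)
  fix B assume B: "B \<subseteq> M1 \<union> M2" "B \<noteq> {}"
  define B1 B2 where "B1 = B \<inter> M1" and "B2 = B \<inter> M2"
  have BU: "B = B2 \<union> B1" and sub: "B1 \<subseteq> M1" "B2 \<subseteq> M2" and dis: "B2 \<inter> B1 = {}"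
    using B fin by (auto simp: B1_def B2_def)
  have fB: "finite B1" "finite B2" using fin sub finite_subset by blast+
  have eB: "edge_count m B = edge_count m B2 + edge_count m B1 + (\<Sum>x\<in>B2. degree m x B1)"
    unfolding BU using edge_count_Un[OF m fB(2,1) dis] .
  have cB: "card B = card B2 + card B1" unfolding BU using card_Un_disjoint[OF fB(2,1) dis] .
  have sB: "sum w B = sum w B2 + sum w B1" unfolding BU using sum.union_disjoint[OF fB(2,1) dis] .
  have sw1: "sum w B1 \<le> sum w1 B1" and sw2: "sum w B2 \<le> sum w2 B2"
    using w1 w2 sub by (auto intro!: sum_mono)
  have crB: "(\<Sum>x\<in>B2. degree m x B1) \<le> 1"
  proof -
    have "(\<Sum>x\<in>B2. degree m x B1) \<le> (\<Sum>x\<in>B2. degree m x M1)"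
      using degree_mono[OF fin(1) sub(1)] by (intro sum_mono)
    also have "\<dots> \<le> (\<Sum>x\<in>M2. degree m x M1)" using sub fin by (intro sum_mono2) auto
    finally show ?thesis using cross by simp
  qed
  show "edge_count m B < card B \<and> (Suc (edge_count m B) = card B \<longrightarrow> edge_count m B + sum w B \<le> D)"
  proof (cases "B1 = {} \<or> B2 = {}")
    case True
    then show ?thesis
    proof
      assume e: "B1 = {}"
      then have "B = B2" using BU by simp
      then show ?thesis using bounded_on_D[OF g2 sub(2)] sw2 B(2) by force
    next
      assume e: "B2 = {}"
      then have "B = B1" using BU by simp
      then show ?thesis using bounded_on_D[OF g1 sub(1)] sw1 B(2) by force
    qed
  next
    case False
    note d1 = bounded_on_D[OF g1 sub(1)] and d2 = bounded_on_D[OF g2 sub(2)]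
    have l: "edge_count m B1 < card B1" "edge_count m B2 < card B2" using d1(1) d2(1) False by auto
    have "edge_count m B + sum w B \<le> D" if eq: "Suc (edge_count m B) = card B"
    proof -
      have e1: "Suc (edge_count m B1) = card B1" and e2: "Suc (edge_count m B2) = card B2"
        and c1: "(\<Sum>x\<in>B2. degree m x B1) = 1"
        using eq l eB cB crB by linarith+
      obtain x where x: "x \<in> B2" "0 < degree m x B1"
        using c1 by (metis neq0_conv sum.neutral zero_neq_one)
      obtain s where s: "s \<in> B1" "0 < m x s" using degree_pos[OF x(2)] by blast
      have "w x + w s + D + 1 \<le> w2 x + w1 s" using rs s x sub by auto
      moreover have "sum w B1 + w1 s \<le> sum w1 B1 + w s"
        using sum_mono[of "B1 - {s}" w w1] w1 sub fB s(1)
        by (simp add: sum.remove[of B1 s] subset_iff)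
      moreover have "sum w B2 + w2 x \<le> sum w2 B2 + w x"
        using sum_mono[of "B2 - {x}" w w2] w2 sub fB x(1)
        by (simp add: sum.remove[of B2 x] subset_iff)
      ultimately show ?thesis
        using d1(2)[OF _ e1] d2(2)[OF _ e2] False eB c1 sB by linarith
    qed
    then show ?thesis using l eB cB crB by linarith
  qed
qed

lemma bounded_on_insert:
  assumes m: "mult_fun m" and "finite M" "v \<notin> M" and g: "bounded_on D m w' M" and d: "degree m v M \<le> 1"
    and wv: "w v \<le> D" and le: "\<And>y. y \<in> M \<Longrightarrow> w y \<le> w' y"
    and rs: "\<And>y. y \<in> M \<Longrightarrow> 0 < m v y \<Longrightarrow> w y + w v + 1 \<le> w' y"
  shows "bounded_on D m w (insert v M)"
proof -
  \<comment> \<open>Giving \<open>v\<close> the auxiliary weight \<open>D\<close> leaves a raise of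
    \<open>w v + 1\<close> to be found at its neighbour.\<close>
  have "bounded_on D m w (M \<union> {v})"
  proof (rule bounded_on_join[OF m \<open>finite M\<close> _ _ g bounded_on_sing[OF m, of "\<lambda>_. D" v]])
    fix s x assume "s \<in> M" "x \<in> {v}" "0 < m x s"
    then show "w x + w s + D + 1 \<le> D + w' s" using rs by fastforce
  qed (use assms in auto)
  then show ?thesis by simp
qed

text \<open>The extra edges of \<open>m'\<close> inside a set make up for all but one of its edges
  to \<open>v\<close>. With \<open>m' = m\<close> this attaches a leaf; with one added edge it is
  subdivision.\<close>

lemma acyclic_on_insert_gen:
  assumes m: "mult_fun m" and "finite F" "v \<notin> F" and le: "\<And>x y. m x y \<le> m' x y" and g: "acyclic_on m' F"
    and d: "\<And>A. A \<subseteq> F \<Longrightarrow> A \<noteq> {} \<Longrightarrow> edge_count m A + degree m v A \<le> edge_count m' A + 1"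
  shows "acyclic_on m (insert v F)"
  unfolding acyclic_on_def
proof (intro allI impI)
  fix B assume B: "B \<subseteq> insert v F" "B \<noteq> {}"
  define A where "A = B - {v}"
  have A: "A \<subseteq> F" using B by (auto simp: A_def)
  then have fA: "finite A" using assms finite_subset by blast
  show "edge_count m B < card B"
  proof (cases "v \<in> B")
    case True
    then have BA: "B = insert v A" "v \<notin> A" by (auto simp: A_def)
    have "edge_count m B = edge_count m A + degree m v A" using BA edge_count_insert[OF m fA] by simp
    moreover have "card B = Suc (card A)" using BA fA by simp
    ultimately show ?thesis
      using d[OF A] acyclic_on_D[OF g A] by (cases "A = {}") auto
  next
    case False
    then have "B = A" by (auto simp: A_def)
    then show ?thesis using acyclic_on_D[OF g A] B edge_count_mono_fun[of m m' A, OF le] by force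
  qed
qed

lemma acyclic_on_insert:
  assumes "mult_fun m" "finite F" "v \<notin> F" "acyclic_on m F" "degree m v F \<le> 1"
  shows "acyclic_on m (insert v F)"
proof (rule acyclic_on_insert_gen[OF assms(1-3) _ assms(4)])
  fix A assume "A \<subseteq> F"
  then show "edge_count m A + degree m v A \<le> edge_count m A + 1"
    using degree_mono[OF \<open>finite F\<close>, of A m v] assms(5) by simp
qed simp

text \<open>A set with both \<open>x\<close> and \<open>y\<close> gains two edges to
  \<open>v\<close> but loses the added edge \<open>x y\<close>; a set with one of them gains one
  edge only.\<close>

lemma acyclic_on_subdivide:
  assumes m: "mult_fun m" and "finite F" "v \<notin> F" "x \<noteq> y" and g: "acyclic_on (add_edge x y m) F"
    and d: "degree m v (F - {x, y}) = 0" "m v x \<le> 1" "m v y \<le> 1"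
  shows "acyclic_on m (insert v F)"
proof (rule acyclic_on_insert_gen[OF m \<open>finite F\<close> \<open>v \<notin> F\<close> _ g])
  fix A assume A: "A \<subseteq> F"
  then have fA: "finite A" using assms finite_subset by blast
  have "degree m v (A - {x, y}) \<le> degree m v (F - {x, y})" using A \<open>finite F\<close> by (intro degree_mono) auto
  moreover have "degree m v A = degree m v (A - {x, y}) + degree m v (A \<inter> {x, y})"
    using degree_Un[of "A - {x, y}" "A \<inter> {x, y}" m v] fA by (auto simp: Un_Diff_Int)
  moreover have "degree m v (A \<inter> {x, y}) = (if x \<in> A then m v x else 0) + (if y \<in> A then m v y else 0)"
    using \<open>x \<noteq> y\<close> by (auto simp: degree_insert Int_insert_right)
  ultimately show "edge_count m A + degree m v A \<le> edge_count (add_edge x y m) A + 1"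
    using d edge_count_add_edge[OF m fA \<open>x \<noteq> y\<close>] by auto
qed (simp add: add_edge_def)

text \<open>A vertex of degree at most three either has at most one edge to F, or at most one edge to M;
  in the latter case the raised weights of its neighbours leave room for it in M.\<close>

lemma wcolorable_insert3:
  assumes m: "mult_fun m" and fin: "finite M" "finite F" and v: "v \<notin> M" "v \<notin> F"
    and dis: "M \<inter> F = {}" and g: "bounded_on D m w' M" "acyclic_on m F" and d: "degree m v (M \<union> F) \<le> 3"
    and wv: "w v \<le> D" and le: "\<And>y. y \<in> M \<Longrightarrow> w y \<le> w' y"
    and rs: "\<And>y. y \<in> M \<Longrightarrow> 0 < m v y \<Longrightarrow> w y + w v + 1 \<le> w' y"
  shows "\<exists>M' F'. M' \<union> F' = insert v (M \<union> F) \<and> M' \<inter> F' = {} \<and> M \<subseteq> M' \<and> F \<subseteq> F' \<and> bounded_on D m w M' \<and> acyclic_on m F'"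
proof (cases "degree m v F \<le> 1")
  case True
  have "acyclic_on m (insert v F)" using acyclic_on_insert[OF m fin(2) v(2) g(2) True] .
  moreover have "bounded_on D m w M" using bounded_on_mono_weight[OF g(1) le] .
  ultimately show ?thesis using v dis by (intro exI[of _ M] exI[of _ "insert v F"]) auto
next
  case False
  then have "degree m v M \<le> 1" using d degree_Un[OF fin dis] by simp
  then have "bounded_on D m w (insert v M)" using bounded_on_insert[OF m fin(1) v(1) g(1) _ wv le rs] by blast
  then show ?thesis using v dis g by (intro exI[of _ "insert v M"] exI[of _ F]) auto
qed

text \<open>The new vertex takes over a name \<open>f\<close>, in use one from the contracted set,
  so that the smaller graph lives on the same type and the induction hypothesis applies to
  it.\<close>

definition contract :: "'a \<Rightarrow> 'a set \<Rightarrow> ('a \<Rightarrow> 'a \<Rightarrow> nat) \<Rightarrow> 'a \<Rightarrow> 'a \<Rightarrow> nat" where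
  "contract f A m = (\<lambda>x y. if x = f then (if y = f then 0 else degree m y A)
                           else if y = f then degree m x A else m x y)"

lemma mult_fun_contract: "mult_fun m \<Longrightarrow> mult_fun (contract f A m)"
  by (auto simp: mult_fun_def contract_def)

lemma degree_contract: "f \<notin> B \<Longrightarrow> degree (contract f A m) f B = (\<Sum>x\<in>B. degree m x A)"
  unfolding degree_def[of "contract f A m"] by (rule sum.cong) (auto simp: contract_def)

lemma edge_count_contract: "f \<notin> B \<Longrightarrow> edge_count (contract f A m) B = edge_count m B"
  by (rule edge_count_cong) (auto simp: contract_def)

text \<open>For a set meeting both A and F, joining \<open>f\<close> to its part B2 in F counts all
  edges from B2 to A. So at most \<open>card B2 - edge_count m B2\<close> edges cross, while the
  part in A has fewer edges than vertices.\<close>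

lemma acyclic_on_contract:
  assumes m: "mult_fun m" and fin: "finite A" "finite F" and f: "f \<notin> F" and dis: "A \<inter> F = {}"
    and g: "acyclic_on m A" "acyclic_on (contract f A m) (insert f F)"
  shows "acyclic_on m (A \<union> F)"
  unfolding acyclic_on_def
proof (intro allI impI)
  fix B assume B: "B \<subseteq> A \<union> F" "B \<noteq> {}"
  define B1 B2 where "B1 = B \<inter> A" and "B2 = B \<inter> F"
  have BU: "B = B2 \<union> B1" and sub: "B1 \<subseteq> A" "B2 \<subseteq> F" and dis': "B2 \<inter> B1 = {}" and f2: "f \<notin> B2"
    using B fin f dis by (auto simp: B1_def B2_def)
  have fB: "finite B1" "finite B2" using fin sub finite_subset by blast+
  have eB: "edge_count m B = edge_count m B2 + edge_count m B1 + (\<Sum>x\<in>B2. degree m x B1)"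
    unfolding BU using edge_count_Un[OF m fB(2,1) dis'] .
  have cB: "card B = card B2 + card B1" unfolding BU using card_Un_disjoint[OF fB(2,1) dis'] .
  show "edge_count m B < card B"
  proof (cases "B1 = {}")
    case True
    then have "B = B2" using BU by simp
    then show ?thesis
      using acyclic_on_D[OF g(2), of B2] B sub edge_count_contract[OF f2] by force
  next
    case False
    have "edge_count (contract f A m) (insert f B2) < card (insert f B2)"
      using acyclic_on_D[OF g(2), of "insert f B2"] sub by auto
    then have "edge_count m B2 + (\<Sum>x\<in>B2. degree m x A) < card B2 + 1"
      using f2 fB by (simp add: edge_count_insert[OF mult_fun_contract[OF m]] edge_count_contract degree_contract)
    moreover have "(\<Sum>x\<in>B2. degree m x B1) \<le> (\<Sum>x\<in>B2. degree m x A)"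
      using degree_mono[OF fin(1) sub(1)] by (intro sum_mono)
    moreover have "edge_count m B1 < card B1" using acyclic_on_D[OF g(1) sub(1) False] .
    ultimately show ?thesis using eB cB by linarith
  qed
qed

text \<open>A weight above \<open>D\<close> forces a vertex into the F-part. Hence \<open>f\<close>
  ends up there and can be expanded to FS, and among the outer vertices with edges to MS only
  \<open>x0\<close> can join the M-part. It brings at most one edge, for which \<open>w1\<close> and
  \<open>w'\<close> share the raise \<open>D + 1\<close> that \<open>bounded_on_join\<close> asks
  for.\<close>

lemma wcolorable_contract:
  assumes m: "mult_fun m" and fV: "finite V" and S: "S \<subseteq> V" "f \<in> S"
    and MF: "MS \<union> FS = S" "MS \<inter> FS = {}" "bounded_on D m w1 MS" "acyclic_on m FS" and w1: "\<And>s. w s \<le> w1 s"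
    and d1: "\<And>x. x \<in> V - S \<Longrightarrow> degree m x S \<le> 1"
    and c': "wcolorable D (contract f FS m) w' (insert f (V - S))"
    and wf: "D < w' f" and w': "\<And>x. x \<in> V - S \<Longrightarrow> w x \<le> w' x"
    and big: "\<And>x. x \<in> V - S \<Longrightarrow> 0 < degree m x MS \<Longrightarrow> x \<noteq> x0 \<Longrightarrow> D < w' x"
    and x0: "\<And>s. s \<in> MS \<Longrightarrow> x0 \<in> V - S \<Longrightarrow> 0 < m x0 s \<Longrightarrow> w x0 + w s + D + 1 \<le> w' x0 + w1 s"
  shows "wcolorable D m w V"
proof -
  obtain M' F' where c: "M' \<union> F' = insert f (V - S)" "M' \<inter> F' = {}"
    "bounded_on D (contract f FS m) w' M'" "acyclic_on (contract f FS m) F'"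
    using c' unfolding wcolorable_def by blast
  have fM: "f \<notin> M'" using bounded_on_weight[OF mult_fun_contract[OF m] c(3)] wf by force
  then have fF: "f \<in> F'" and M'V: "M' \<subseteq> V - S" using c by auto
  define F2 where "F2 = F' - {f}"
  have F2: "F' = insert f F2" "f \<notin> F2" "F2 \<subseteq> V - S" using fF c S by (auto simp: F2_def)
  have fin: "finite MS" "finite FS" "finite M'" "finite F2"
    using S MF(1) M'V F2(3) by (auto intro: finite_subset[OF _ fV])
  have "acyclic_on m (FS \<union> F2)"
    using acyclic_on_contract[OF m fin(2,4) F2(2) _ MF(4)] c(4) F2 MF by auto
  moreover have "bounded_on D m w (MS \<union> M')"
  proof (rule bounded_on_join[OF m fin(1,3) _ MF(3)])
    have "edge_count (contract f FS m) B = edge_count m B" if "B \<subseteq> M'" for B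
      using that fM by (intro edge_count_contract) auto
    then show "bounded_on D m w' M'" using c(3) by (simp add: bounded_on_def)
    show "MS \<inter> M' = {}" using MF M'V by auto
    have only: "x = x0" if "x \<in> M'" "0 < degree m x MS" for x
      using big[of x] that M'V bounded_on_weight[OF mult_fun_contract[OF m] c(3) that(1)] by force
    show "w x + w s + D + 1 \<le> w' x + w1 s" if "s \<in> MS" "x \<in> M'" "0 < m x s" for s x
    proof -
      have "0 < degree m x MS" using degree_ge[OF fin(1) that(1), of m x] that by simp
      then have "x = x0" using only that by simp
      then show ?thesis using x0 that M'V by auto
    qed
    have "(\<Sum>x\<in>M'. degree m x MS) = (\<Sum>x\<in>M' \<inter> {x0}. degree m x MS)"
      using only fin by (intro sum.mono_neutral_right) auto
    also have "\<dots> \<le> 1"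
    proof (cases "x0 \<in> M'")
      case True
      then have "degree m x0 MS \<le> degree m x0 S" using MF fV S finite_subset by (intro degree_mono) auto
      then show ?thesis using True d1[of x0] M'V by auto
    qed simp
    finally show "(\<Sum>x\<in>M'. degree m x MS) \<le> 1" .
  qed (use w1 w' M'V in auto)
  moreover have "(MS \<union> M') \<union> (FS \<union> F2) = V" using c F2 fM MF S by auto
  moreover have "(MS \<union> M') \<inter> (FS \<union> F2) = {}" using c F2 fM MF S M'V by auto
  ultimately show ?thesis by (intro wcolorableI[of "MS \<union> M'" "FS \<union> F2"])
qed

section \<open>The potential and the gap lemma\<close>

definition pot :: "(nat \<Rightarrow> int) \<Rightarrow> int \<Rightarrow> ('a \<Rightarrow> 'a \<Rightarrow> nat) \<Rightarrow> ('a \<Rightarrow> nat) \<Rightarrow> 'a set \<Rightarrow> int" where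
  "pot a k m w S = (\<Sum>v\<in>S. a (w v)) - k * int (edge_count m S)"

lemma pot_insert:
  "mult_fun m \<Longrightarrow> finite S \<Longrightarrow> v \<notin> S \<Longrightarrow>
     pot a k m w (insert v S) = pot a k m w S + a (w v) - k * int (degree m v S)"
  by (simp add: pot_def edge_count_insert algebra_simps)

lemma pot_singleton [simp]: "mult_fun m \<Longrightarrow> pot a k m w {v} = a (w v)"
  by (simp add: pot_def)

lemma pot_Un:
  "mult_fun m \<Longrightarrow> finite S \<Longrightarrow> finite T \<Longrightarrow> S \<inter> T = {} \<Longrightarrow>
     pot a k m w (S \<union> T) = pot a k m w S + pot a k m w T - k * int (\<Sum>x\<in>S. degree m x T)"
  by (simp add: pot_def edge_count_Un sum.union_disjoint algebra_simps)

lemma pot_add_edge: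
  "mult_fun m \<Longrightarrow> finite S \<Longrightarrow> x \<noteq> y \<Longrightarrow>
     pot a k (add_edge x y m) w S = pot a k m w S - (if x \<in> S \<and> y \<in> S then k else 0)"
  by (simp add: pot_def edge_count_add_edge algebra_simps)

lemma pot_raise:
  assumes "\<And>v. v \<in> S \<Longrightarrow> a (w v) \<le> a (w' v) + c v"
  shows "pot a k m w S \<le> pot a k m w' S + sum c S"
proof -
  have "(\<Sum>v\<in>S. a (w v)) \<le> (\<Sum>v\<in>S. a (w' v) + c v)" using assms by (intro sum_mono)
  then show ?thesis by (simp add: pot_def sum.distrib)
qed

lemma int_mult_mono: "x \<le> y \<Longrightarrow> 0 \<le> k \<Longrightarrow> k * int x \<le> k * int y"
  by (simp add: mult_left_mono)

text \<open>The two sides differ by \<open>k\<close> times the number of edges between A - B and B -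
  A.\<close>

lemma pot_submodular:
  assumes m: "mult_fun m" and fin: "finite A" "finite B" and "0 \<le> k"
  shows "pot a k m w (A \<union> B) + pot a k m w (A \<inter> B) \<le> pot a k m w A + pot a k m w B"
proof -
  define I A' B' where "I = A \<inter> B" and "A' = A - B" and "B' = B - A"
  have A: "A = A' \<union> I" and B: "B = B' \<union> I" and AB: "A \<union> B = A' \<union> B"
    and dis: "A' \<inter> I = {}" "B' \<inter> I = {}" "A' \<inter> B = {}"
    by (auto simp: I_def A'_def B'_def)
  have f: "finite I" "finite A'" "finite B'" using fin by (auto simp: I_def A'_def B'_def)
  have "(\<Sum>x\<in>A'. degree m x I) \<le> (\<Sum>x\<in>A'. degree m x B)"
    using degree_mono[OF fin(2), of I m] by (intro sum_mono) (auto simp: I_def)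
  then have "k * int (\<Sum>x\<in>A'. degree m x I) \<le> k * int (\<Sum>x\<in>A'. degree m x B)"
    using \<open>0 \<le> k\<close> by (rule int_mult_mono)
  moreover have "pot a k m w A = pot a k m w A' + pot a k m w I - k * int (\<Sum>x\<in>A'. degree m x I)"
    unfolding A using pot_Un[OF m f(2,1) dis(1)] .
  moreover have "pot a k m w (A \<union> B) = pot a k m w A' + pot a k m w B - k * int (\<Sum>x\<in>A'. degree m x B)"
    unfolding AB using pot_Un[OF m f(2) fin(2) dis(3)] .
  ultimately show ?thesis by (simp add: I_def)
qed

lemma wcolorable_empty [simp]: "wcolorable D m w {}"
  by (auto simp: wcolorable_def)

lemma wcolorable_disjoint:
  assumes m: "mult_fun m" and fV: "finite V" and S: "S \<subseteq> V"
    and c: "wcolorable D m w S" "wcolorable D m w (V - S)" and no: "\<And>x s. x \<in> V - S \<Longrightarrow> s \<in> S \<Longrightarrow> m x s = 0"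
  shows "wcolorable D m w V"
proof (cases "S = {}")
  case False
  then obtain f where f: "f \<in> S" by auto
  obtain M1 F1 where 1: "M1 \<union> F1 = S" "M1 \<inter> F1 = {}" "bounded_on D m w M1" "acyclic_on m F1"
    using c(1) unfolding wcolorable_def by blast
  obtain M2 F2 where 2: "M2 \<union> F2 = V - S" "M2 \<inter> F2 = {}" "bounded_on D m w M2" "acyclic_on m F2"
    using c(2) unfolding wcolorable_def by blast
  have fin: "finite M1" "finite F1" "finite M2" "finite F2"
    using S 1(1) 2(1) by (auto intro: finite_subset[OF _ fV])
  have z: "degree m x A = 0" if "x \<in> V - S" "A \<subseteq> S" for x A
    using no that unfolding degree_def by (intro sum.neutral) blast
  have fF2: "f \<notin> F2" using f 2(1) by auto
  have "bounded_on D m w (M1 \<union> M2)"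
  proof (rule bounded_on_join[OF m fin(1,3) _ 1(3) 2(3)])
    show "(\<Sum>x\<in>M2. degree m x M1) \<le> 1" using z 1(1) 2(1) by (subst sum.neutral) auto
    show "w x + w s + D + 1 \<le> w x + w s" if "s \<in> M1" "x \<in> M2" "0 < m x s" for s x
      using no[of x s] that 1(1) 2(1) by auto
  qed (use 1 2 in auto)
  moreover have "acyclic_on m (F1 \<union> F2)"
  \<comment> \<open>No edge crosses, so the contracted vertex \<open>f\<close> is isolated in the
    second part.\<close>
  proof (rule acyclic_on_contract[OF m fin(2,4) fF2 _ 1(4)])
    have "acyclic_on (contract f F1 m) F2"
      unfolding acyclic_on_def
    proof (intro allI impI)
      fix B assume B: "B \<subseteq> F2" "B \<noteq> {}"
      then have "f \<notin> B" using fF2 by auto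
      then show "edge_count (contract f F1 m) B < card B" using acyclic_on_D[OF 2(4) B] by (simp add: edge_count_contract)
    qed
    moreover have "degree (contract f F1 m) f F2 = 0"
      using z 1(1) 2(1) unfolding degree_contract[OF fF2] by (intro sum.neutral) auto
    ultimately show "acyclic_on (contract f F1 m) (insert f F2)"
      using acyclic_on_insert[OF mult_fun_contract[OF m] fin(4) fF2] by simp
  qed (use 1 2 in auto)
  moreover have "(M1 \<union> M2) \<union> (F1 \<union> F2) = V" "(M1 \<union> M2) \<inter> (F1 \<union> F2) = {}" using 1 2 S by auto
  ultimately show ?thesis by (intro wcolorableI[of "M1 \<union> M2" "F1 \<union> F2"])
qed (use c in simp)

text \<open>The last assumption trades a raise by \<^term>\<open>j\<close> at one end of an edge between a contracted set
  and its complement against a raise by \<^term>\<open>D + 1 - j\<close> at the other end.\<close>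

locale weights =
  fixes D :: nat and k :: int and a :: "nat \<Rightarrow> int"
  assumes a_le: "a n \<le> 2 * k - 1" and a_ge: "k - 1 \<le> a n" and a_big: "D < n \<Longrightarrow> a n = k - 1"
    and a_step: "a n \<le> a (n + i) + 2 * int i" and k3: "3 \<le> k"
    and trade: "- 1 \<le> r \<Longrightarrow> r < k \<Longrightarrow>
      \<exists>j. a u - a (u + j) \<le> r + 1 \<and> (D < u + j \<or> a x - a (x + (D + 1 - j)) \<le> k - r)"
begin

abbreviation "p \<equiv> pot a k"

lemma raise_pot:
  "p m w T - 2 * int (\<Sum>z\<in>T. r z) \<le> p m (\<lambda>z. w z + r z) T"
proof -
  have "p m w T \<le> p m (\<lambda>z. w z + r z) T + (\<Sum>z\<in>T. 2 * int (r z))"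
    by (rule pot_raise) (rule a_step)
  then show ?thesis by (simp add: sum_distrib_left)
qed

text \<open>Edges from T to MS disappear, which frees \<open>k\<close> each to pay for the raised
  weights; \<open>l\<close> records what the raise at a vertex leaves over. Edges from T to FS also
  disappear if the contracted vertex is left out, and survive as edges to \<open>f\<close>
  otherwise.\<close>

lemma contract_pot:
  assumes m: "mult_fun m" and fin: "finite S" "finite T" "S \<inter> T = {}" and f: "f \<notin> T"
    and MF: "MS \<union> FS = S" "MS \<inter> FS = {}"
    and l: "\<And>x. x \<in> T \<Longrightarrow> a (w x) \<le> a (w' x) + k * int (degree m x MS) - l x"
  shows "p m w (T \<union> S) - p m w S + k * int (\<Sum>x\<in>T. degree m x FS) + sum l T \<le> p (contract f FS m) w' T"
    and "p m w (T \<union> S) - p m w S + a (w' f) + sum l T \<le> p (contract f FS m) w' (insert f T)"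
proof -
  have fMF: "finite MS" "finite FS" using fin MF by (auto intro: finite_subset)
  have "p m w T \<le> p m w' T + (\<Sum>x\<in>T. k * int (degree m x MS) - l x)"
    by (rule pot_raise) (use l in force)
  also have "(\<Sum>x\<in>T. k * int (degree m x MS) - l x) = k * int (\<Sum>x\<in>T. degree m x MS) - sum l T"
    by (simp add: sum_subtractf sum_distrib_left)
  finally have 1: "p m w T \<le> p m w' T + (k * int (\<Sum>x\<in>T. degree m x MS) - sum l T)" .
  have "p m w (T \<union> S) = p m w T + p m w S - k * int (\<Sum>x\<in>T. degree m x S)"
    using pot_Un[OF m fin(2,1)] fin(3) by (simp add: Int_commute)
  moreover have "(\<Sum>x\<in>T. degree m x S) = (\<Sum>x\<in>T. degree m x MS) + (\<Sum>x\<in>T. degree m x FS)"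
    unfolding MF(1)[symmetric] using degree_Un[OF fMF MF(2)] by (simp add: sum.distrib)
  moreover have e: "p (contract f FS m) w' T = p m w' T" by (simp add: pot_def edge_count_contract[OF f])
  ultimately show 2: "p m w (T \<union> S) - p m w S + k * int (\<Sum>x\<in>T. degree m x FS) + sum l T \<le> p (contract f FS m) w' T"
    using 1 by (simp add: algebra_simps)
  have "p (contract f FS m) w' (insert f T) =
      p (contract f FS m) w' T + a (w' f) - k * int (\<Sum>x\<in>T. degree m x FS)"
    using pot_insert[OF mult_fun_contract[OF m] fin(2) f] degree_contract[OF f] by simp
  with 2 show "p m w (T \<union> S) - p m w S + a (w' f) + sum l T \<le> p (contract f FS m) w' (insert f T)"
    by linarith
qed

text \<open>Common core of \<open>gap2\<close> and \<open>critical_pot\<close>. By minimality,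
  adding T' to S does not lower the potential unless this gives all of V, where only
  \<open>-1\<close> is known. Then an amount \<open>p m w S\<close> is missing. It comes from the
  cheaper raise of \<open>x0\<close> if \<open>s0\<close> is in MS, from the edge between
  \<open>x0\<close> and FS if not, and from the contracted vertex, of potential
  \<open>k - 1\<close>, if that belongs to T.\<close>

lemma contract_step:
  assumes m: "mult_fun m" and fV: "finite V" and SV: "S \<subseteq> V" and potV: "- 1 \<le> p m w V"
    and r: "p m w S < k" and min: "\<And>B. S \<subset> B \<Longrightarrow> B \<subset> V \<Longrightarrow> p m w S \<le> p m w B"
    and d1: "\<And>x. x \<in> V - S \<Longrightarrow> degree m x S \<le> 1"
    and x0: "x0 \<in> V - S" and s0: "s0 \<in> S" and e0: "0 < m x0 s0"
    and MF: "MS \<union> FS = S" "MS \<inter> FS = {}" "bounded_on D m (w(s0 := w s0 + j)) MS" "acyclic_on m FS"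
    and tr: "s0 \<in> MS \<Longrightarrow> 0 \<le> p m w S \<Longrightarrow> a (w x0) - a (w x0 + (D + 1 - j)) \<le> k - p m w S"
    and wcolorableI: "\<And>m' w'. mult_fun m' \<Longrightarrow>
      (\<And>T. T \<subseteq> insert s0 (V - S) \<Longrightarrow> T \<noteq> {} \<Longrightarrow> - 1 \<le> p m' w' T) \<Longrightarrow> wcolorable D m' w' (insert s0 (V - S))"
  shows "wcolorable D m w V"
proof -
  have fin: "finite S" "finite MS" "finite FS"
    using SV MF(1) by (auto intro: finite_subset[OF _ fV])
  \<comment> \<open>\<open>s0\<close> now stands for the contracted FS. Outer neighbours of MS are
    forced into F, except \<open>x0\<close>, whose raise is shortened by the \<open>j\<close>
    already granted to \<open>s0\<close>.\<close>
  define w' where "w' = (\<lambda>x. if x = s0 then D + 1 else if degree m x MS = 0 then w x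
     else if x = x0 then w x + (D + 1 - j) else w x + (D + 1))"
  define l where "l = (\<lambda>x. if x = x0 \<and> s0 \<in> MS then max (p m w S) 0 else 0)"
  have mc: "mult_fun (contract s0 FS m)" using mult_fun_contract[OF m] .
  have x0s0: "x0 \<noteq> s0" using x0 s0 by auto
  have dMS: "degree m x MS \<le> degree m x S" "degree m x FS \<le> degree m x S" for x
    using MF(1) fin by (auto intro!: degree_mono)
  have cost: "a u - a v \<le> k" for u v using a_le[of u] a_ge[of v] by linarith
  have l: "a (w x) \<le> a (w' x) + k * int (degree m x MS) - l x" if x: "x \<in> V - S" for x
  proof (cases "degree m x MS = 0")
    case True
    then have "\<not> (x = x0 \<and> s0 \<in> MS)" using degree_ge[OF fin(2), of s0 m x0] e0 by auto
    then show ?thesis using True x s0 by (auto simp: w'_def l_def)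
  next
    case False
    then have d: "degree m x MS = 1" using dMS(1)[of x] d1[OF x] by linarith
    show ?thesis
    proof (cases "x = x0 \<and> s0 \<in> MS \<and> 0 \<le> p m w S")
      case True
      then show ?thesis using tr d x0s0 by (auto simp: w'_def l_def)
    next
      case False
      then have "l x = 0" by (auto simp: l_def)
      then show ?thesis using cost[of "w x" "w' x"] d by simp
    qed
  qed
  have l0: "0 \<le> sum l T" for T by (rule sum_nonneg) (simp add: l_def)
  have wcolorable: "wcolorable D (contract s0 FS m) w' (insert s0 (V - S))"
  proof (rule wcolorableI[OF mc])
    fix T assume T: "T \<subseteq> insert s0 (V - S)" "T \<noteq> {}"
    define T' where "T' = T - {s0}"
    have T': "T' \<subseteq> V - S" "s0 \<notin> T'" "finite T'" "S \<inter> T' = {}"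
      using T s0 fV finite_subset[OF T(1)] by (auto simp: T'_def)
    note cp = contract_pot[OF m fin(1) T'(3,4,2) MF(1,2), of w w' l]
    have lT: "\<And>x. x \<in> T' \<Longrightarrow> a (w x) \<le> a (w' x) + k * int (degree m x MS) - l x" using l T' by auto
    have cp1: "p m w (T' \<union> S) - p m w S + k * int (\<Sum>x\<in>T'. degree m x FS) + sum l T' \<le> p (contract s0 FS m) w' T'"
      and cp2: "p m w (T' \<union> S) - p m w S + a (w' s0) + sum l T' \<le> p (contract s0 FS m) w' (insert s0 T')"
      by (rule cp; rule lT; assumption)+
    have pV: "- 1 \<le> p m w (T' \<union> S)" if "T' \<union> S = V" using that potV by simp
    have pN: "p m w S \<le> p m w (T' \<union> S)" if "T' \<union> S \<noteq> V" "T' \<noteq> {}"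
      using that T' SV by (intro min) auto
    have kF: "0 \<le> k * int (\<Sum>x\<in>T'. degree m x FS)" using k3 by (intro mult_nonneg_nonneg of_nat_0_le_iff) simp
    show "- 1 \<le> p (contract s0 FS m) w' T"
    proof (cases "s0 \<in> T")
      case True
      then have TT: "T = insert s0 T'" by (auto simp: T'_def)
      have a: "a (w' s0) = k - 1" using a_big by (simp add: w'_def)
      show ?thesis
      proof (cases "T' = {}")
        case True
        then show ?thesis using TT a k3 mc by simp
      next
        case False
        then have "p m w S - k \<le> p m w (T' \<union> S)" using pV pN r k3 by (cases "T' \<union> S = V") simp_all
          then show ?thesis unfolding TT using cp2 l0[of T'] a k3 by linarith
      qed
    next
      case False
      then have TT: "T = T'" by (auto simp: T'_def)
      show ?thesis
      proof (cases "T' \<union> S = V")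
        case True
        then have x0T: "x0 \<in> T'" using x0 by auto
        show ?thesis
        proof (cases "s0 \<in> MS")
          case True
          have "l x0 \<le> sum l T'" using x0T T' by (intro member_le_sum) (auto simp: l_def)
          then have "p m w S \<le> sum l T'" using True by (simp add: l_def)
          then show ?thesis unfolding TT using cp1 kF pV[OF \<open>T' \<union> S = V\<close>] by linarith
        next
          case False
          then have "s0 \<in> FS" using MF s0 by auto
          then have "1 \<le> degree m x0 FS" using degree_ge[OF fin(3), of s0 m x0] e0 by linarith
          also have "\<dots> \<le> (\<Sum>x\<in>T'. degree m x FS)" using x0T T' by (intro member_le_sum) auto
          finally have "k * int 1 \<le> k * int (\<Sum>x\<in>T'. degree m x FS)"
            using k3 by (intro int_mult_mono) simp_all
          then show ?thesis unfolding TT using cp1 l0[of T'] pV[OF \<open>T' \<union> S = V\<close>] r by simp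
        qed
      next
        case False
        then show ?thesis unfolding TT using cp1 l0[of T'] pN[OF False] kF T(2) TT by (cases "T' = {}") simp_all
      qed
    qed
  qed
  show ?thesis
  proof (rule wcolorable_contract[OF m fV SV s0 MF _ d1 wcolorable])
    fix s assume s: "s \<in> MS" "0 < m x0 s"
    have "s = s0"
    proof (rule ccontr)
      assume "s \<noteq> s0"
      then have "m x0 s0 + m x0 s \<le> degree m x0 S"
        using degree_remove[OF fin(1) s0, of m x0] degree_ge[of "S - {s0}" s m x0] s MF(1) fin by auto
      then show False using d1[OF x0] s e0 by linarith
    qed
    then show "w x0 + w s + D + 1 \<le> w' x0 + (w(s0 := w s0 + j)) s"
      using s degree_ge[OF fin(2) s(1), of m x0] x0s0 by (auto simp: w'_def)
  qed (use s0 in \<open>auto simp: w'_def\<close>)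
qed

end

section \<open>Minimal counterexamples and the gap lemma\<close>

locale min_counterexample = weights +
  fixes V :: "'a set" and m :: "'a \<Rightarrow> 'a \<Rightarrow> nat" and w :: "'a \<Rightarrow> nat"
  assumes fV: "finite V" and m: "mult_fun m"
    and IH: "finite (V' :: 'a set) \<Longrightarrow> card V' < card V \<Longrightarrow> mult_fun m' \<Longrightarrow>
       (\<And>S. S \<subseteq> V' \<Longrightarrow> S \<noteq> {} \<Longrightarrow> - 1 \<le> pot a k m' w' S) \<Longrightarrow> wcolorable D m' w' V'"
    and potV: "S \<subseteq> V \<Longrightarrow> S \<noteq> {} \<Longrightarrow> - 1 \<le> pot a k m w S"
    and not_wcolorable: "\<not> wcolorable D m w V"
begin

lemma msym: "m x y = m y x" and mirr [simp]: "m x x = 0"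
  using m by (auto simp: mult_fun_def)

lemma V_ne: "V \<noteq> {}"
  using not_wcolorable by auto

lemma fin: "S \<subseteq> V \<Longrightarrow> finite S"
  using fV finite_subset by blast

text \<open>Minimality is in the number of vertices alone, with multiplicities and weights
  arbitrary: the reductions delete vertices but may add edges and raise weights.\<close>

lemma IHV: "W \<subset> V \<Longrightarrow> mult_fun m' \<Longrightarrow>
       (\<And>S. S \<subseteq> W \<Longrightarrow> S \<noteq> {} \<Longrightarrow> - 1 \<le> p m' w' S) \<Longrightarrow> wcolorable D m' w' W"
  using IH[of W m' w'] fV psubset_card_mono fin by blast

lemma wcolorable_sub: "W \<subset> V \<Longrightarrow> wcolorable D m w W"
  using IHV[of W m w] potV m by blast

lemma dgV: "v \<in> V \<Longrightarrow> degree m v (V - {v}) = degree m v V"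
  using degree_remove[OF fV, of v m v] by simp

lemma deg2: assumes v: "v \<in> V" shows "2 \<le> degree m v V"
proof (rule ccontr)
  assume "\<not> 2 \<le> degree m v V"
  obtain M F where c: "M \<union> F = V - {v}" "M \<inter> F = {}" "bounded_on D m w M" "acyclic_on m F"
    using wcolorable_sub[of "V - {v}"] v unfolding wcolorable_def by blast
  have "degree m v F \<le> degree m v V" using c v by (intro degree_mono[OF fV]) auto
  then have "acyclic_on m (insert v F)"
    using c \<open>\<not> 2 \<le> degree m v V\<close> fin[of F] by (intro acyclic_on_insert[OF m]) auto
  then show False using c v not_wcolorable by (auto intro!: wcolorableI[of M "insert v F"] simp: insert_absorb)
qed

text \<open>With at most two edges at \<open>v\<close>, either at most one goes to the F-part of a
  colouring of the rest, or none goes to the M-part, where \<open>v\<close> is then a component by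
  itself.\<close>

lemma deg3: assumes v: "v \<in> V" "w v \<le> D" shows "3 \<le> degree m v V"
proof (rule ccontr)
  assume d: "\<not> 3 \<le> degree m v V"
  obtain M F where c: "M \<union> F = V - {v}" "M \<inter> F = {}" "bounded_on D m w M" "acyclic_on m F"
    using wcolorable_sub[of "V - {v}"] v unfolding wcolorable_def by blast
  have f: "finite M" "finite F" using c fin[of M] fin[of F] by auto
  show False
  proof (cases "degree m v F \<le> 1")
    case True
    then have "acyclic_on m (insert v F)" using c f by (intro acyclic_on_insert[OF m]) auto
    then show False using c v not_wcolorable by (auto intro!: wcolorableI[of M "insert v F"] simp: insert_absorb)
  next
    case False
    have "degree m v M + degree m v F = degree m v V" using degree_Un[OF f c(2), of m v] c(1) dgV v by simp
    then have "degree m v M = 0" using d False by linarith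
    then have "bounded_on D m w (insert v M)"
      using c(1) f v degree_ge[OF f(1), of _ m v] by (intro bounded_on_insert[OF m _ _ c(3)]) fastforce+
    then show False using c v not_wcolorable by (auto intro!: wcolorableI[of "insert v M" F] simp: insert_absorb)
  qed
qed

lemma gap1: "S \<subset> V \<Longrightarrow> card S = 1 \<Longrightarrow> k - 1 \<le> p m w S"
  using a_ge m by (auto simp: card_1_singleton_iff)

lemma gap2: assumes "S \<subset> V" "2 \<le> card S" shows "k \<le> p m w S"
proof (rule ccontr)
  assume less: "\<not> k \<le> p m w S"
  define \<F> where "\<F> = {B. B \<subset> V \<and> 2 \<le> card B}"
  have F: "finite \<F>" "S \<in> \<F>"
    using fV assms by (auto simp: \<F>_def intro: finite_subset[of _ "Pow V"])
  define A where "A = arg_min_on (p m w) \<F>"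
  have A: "A \<in> \<F>" and min: "\<And>B. B \<in> \<F> \<Longrightarrow> p m w A \<le> p m w B"
    using arg_min_if_finite[of \<F> "p m w"] F unfolding A_def by (auto simp: not_less)
  have AV: "A \<subset> V" "2 \<le> card A" using A by (auto simp: \<F>_def)
  have rk: "p m w A < k" using min[OF F(2)] less by linarith
  have fA: "finite A" using AV fin by auto
  have Ane: "A \<noteq> {}" using AV by auto
  have r1: "- 1 \<le> p m w A" using potV AV Ane by auto
  \<comment> \<open>Two edges from \<open>x\<close> into A outweigh the potential of
    \<open>x\<close>, so \<open>insert x A\<close> would have smaller potential than A. If it is all
    of V, minimality says nothing; but then \<open>x\<close> has three edges, or weight above
    \<open>D\<close> and potential \<open>k - 1\<close>, and V would fall below
    \<open>-1\<close>.\<close>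
  have d1: "degree m x A \<le> 1" if x: "x \<in> V - A" for x
  proof (rule ccontr)
    assume d: "\<not> degree m x A \<le> 1"
    have pi: "p m w (insert x A) = p m w A + a (w x) - k * int (degree m x A)"
      using x by (intro pot_insert[OF m fA]) auto
    have k2: "k * 2 \<le> k * int (degree m x A)" using d k3 by (intro mult_left_mono) auto
    show False
    proof (cases "insert x A = V")
      case False
      then have "insert x A \<in> \<F>" using x AV fA by (auto simp: \<F>_def card_insert_if)
      then show False using min[of "insert x A"] pi k2 a_le[of "w x"] k3 by linarith
    next
      case True
      then have dx: "degree m x A = degree m x V" using degree_self[OF m fA, of x] by simp
      show False
      proof (cases "w x \<le> D")
        case True
        then have "k * 3 \<le> k * int (degree m x A)" using deg3[of x] x dx k3 by (intro mult_left_mono) auto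
        then show False using pi \<open>insert x A = V\<close> potV[of V] V_ne a_le[of "w x"] rk by auto
      next
        case False
        then show False using pi \<open>insert x A = V\<close> potV[of V] V_ne a_big[of "w x"] rk k2 by auto
      qed
    qed
  qed
  show False
  proof (cases "\<exists>x\<in>V - A. \<exists>s\<in>A. 0 < m x s")
    case False
    have "V - A \<subset> V" using AV Ane by auto
    have "m x s = 0" if "x \<in> V - A" "s \<in> A" for x s using False that by auto
    then have "wcolorable D m w V"
      using wcolorable_disjoint[OF m fV psubset_imp_subset[OF AV(1)] wcolorable_sub[OF AV(1)] wcolorable_sub[OF \<open>V - A \<subset> V\<close>]]
      by simp
    then show False using not_wcolorable by simp
  next
    case True
    then obtain x0 s0 where x0: "x0 \<in> V - A" and s0: "s0 \<in> A" and e0: "0 < m x0 s0" by blast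
    \<comment> \<open>\<open>trade\<close> is used at the potential of A; \<open>s0\<close> is
      raised by \<open>j\<close> before A is coloured.\<close>
    obtain j where j: "a (w s0) - a (w s0 + j) \<le> p m w A + 1"
      "D < w s0 + j \<or> a (w x0) - a (w x0 + (D + 1 - j)) \<le> k - p m w A"
      using trade[OF r1 rk] by blast
    let ?w1 = "w(s0 := w s0 + j)"
    \<comment> \<open>Sets with \<open>s0\<close> and another vertex have at least the potential of
      A, so a loss of at most \<open>p m w A + 1\<close> leaves \<open>-1\<close>; a single vertex
      never falls below \<open>k - 1\<close>.\<close>
    have "wcolorable D m ?w1 A"
    proof (rule IHV[OF AV(1) m])
      fix T assume T: "T \<subseteq> A" "T \<noteq> {}"
      have fT: "finite T" using T fA finite_subset by blast
      show "- 1 \<le> p m ?w1 T"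
      proof (cases "card T \<ge> 2 \<and> s0 \<in> T")
        case True
        then have "T \<in> \<F>" using T AV by (auto simp: \<F>_def)
        then have "p m w A \<le> p m w T" using min by simp
        moreover have "p m w T \<le> p m ?w1 T + (\<Sum>v\<in>T. if v = s0 then a (w s0) - a (w s0 + j) else 0)"
          by (rule pot_raise) simp
        ultimately show ?thesis using j(1) fT True by (simp add: sum.delta)
      next
        case False
        show ?thesis
        proof (cases "s0 \<in> T")
          case True
          moreover have "card T \<noteq> 0" using fT T(2) by simp
          ultimately have "card T = 1" using False by linarith
          then obtain t where "T = {t}" by (rule card_1_singletonE)
          then show ?thesis using a_ge[of "?w1 t"] k3 m by simp
        next
          case False
          then have "p m ?w1 T = p m w T" by (auto simp: pot_def intro!: sum.cong)
          then show ?thesis using potV[of T] T AV by auto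
        qed
      qed
    qed
    then obtain MS FS where MF: "MS \<union> FS = A" "MS \<inter> FS = {}" "bounded_on D m ?w1 MS" "acyclic_on m FS"
      unfolding wcolorable_def by blast
    have "wcolorable D m w V"
    proof (rule contract_step[OF m fV _ _ rk _ d1 x0 s0 e0 MF])
      show "A \<subseteq> V" using AV by auto
      show "- 1 \<le> p m w V" using potV V_ne by auto
      show "p m w A \<le> p m w B" if "A \<subset> B" "B \<subset> V" for B
        using that AV card_mono[of B A] fin[of B] by (intro min) (auto simp: \<F>_def)
      \<comment> \<open>If \<open>s0\<close> is coloured M, its raised weight is at most
        \<open>D\<close>, which excludes the first alternative of \<open>trade\<close>.\<close>
      show "a (w x0) - a (w x0 + (D + 1 - j)) \<le> k - p m w A" if "s0 \<in> MS"
        using j(2) bounded_on_weight[OF m MF(3) that] by auto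
      show "wcolorable D m' w' (insert s0 (V - A))"
        if "mult_fun m'" "\<And>T. T \<subseteq> insert s0 (V - A) \<Longrightarrow> T \<noteq> {} \<Longrightarrow> - 1 \<le> p m' w' T" for m' w'
      proof (rule IHV[OF _ that])
        have "\<not> A \<subseteq> {s0}" using AV(2) card_mono[of "{s0}" A] by auto
        then show "insert s0 (V - A) \<subset> V" using AV s0 by auto
      qed auto
    qed
    then show False using not_wcolorable by simp
  qed
qed

lemma gap: assumes "S \<subset> V" "S \<noteq> {}" shows "k - 1 \<le> p m w S"
proof -
  have "card S \<noteq> 0" using assms fin[of S] by auto
  then have "card S = 1 \<or> 2 \<le> card S" by linarith
  then show ?thesis using gap1[OF assms(1)] gap2[OF assms(1)] by linarith
qed

end

section \<open>Reducible vertices of degree three, and the case of even D\<close>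

context min_counterexample
begin

lemma finish: "M \<union> F = V \<Longrightarrow> M \<inter> F = {} \<Longrightarrow> bounded_on D m w M \<Longrightarrow> acyclic_on m F \<Longrightarrow> False"
  using not_wcolorable wcolorableI by blast

lemma raise_dg: "p m w T - 2 * int (b * degree m v T) \<le> p m (\<lambda>z. w z + b * m v z) T"
  using raise_pot[of m w T "\<lambda>z. b * m v z"] by (simp add: degree_def sum_distrib_left)

text \<open>Delete \<open>v\<close> and raise its neighbours by \<open>w v + 1\<close> per edge, at
  cost \<open>2 * (w v + 1)\<close>, so that \<open>wcolorable_insert3\<close> can restore
  \<open>v\<close>. Two raises are paid by the gap \<open>k - 1\<close>: this is the first condition
  in \<open>s\<close>. A set receiving all three raises has at least potential \<open>-1\<close>
  together with \<open>v\<close>, hence at least \<open>3 * k - a (w v) - 1\<close> alone: this is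
  the second.\<close>

lemma light_deg3:
  assumes v: "v \<in> V" "degree m v V = 3" "w v \<le> D"
    and s: "4 * (int (w v) + 1) \<le> k" "a (w v) + 6 * (int (w v) + 1) \<le> 3 * k"
  shows False
proof -
  define w' where "w' = (\<lambda>z. w z + (w v + 1) * m v z)"
  have "wcolorable D m w' (V - {v})"
  proof (rule IHV[OF _ m])
    fix T assume T: "T \<subseteq> V - {v}" "T \<noteq> {}"
    have fT: "finite T" and vT: "v \<notin> T" and TV: "T \<subset> V" using T fin[of T] v by auto
    have r: "p m w T - 2 * int ((w v + 1) * degree m v T) \<le> p m w' T"
      unfolding w'_def by (rule raise_dg)
    have d3: "degree m v T \<le> 3" using degree_mono[OF fV, of T m v] TV v(2) by auto
    show "- 1 \<le> p m w' T"
    proof (cases "degree m v T = 3")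
      case True
      have "p m w (insert v T) = p m w T + a (w v) - k * 3"
        using pot_insert[OF m fT vT] True by simp
      moreover have "- 1 \<le> p m w (insert v T)" by (rule potV) (use TV v(1) in auto)
      ultimately show ?thesis using r True s by simp
    next
      case False
      then have "(w v + 1) * degree m v T \<le> (w v + 1) * 2" using d3 by (intro mult_left_mono) auto
      then have "int ((w v + 1) * degree m v T) \<le> int ((w v + 1) * 2)" by (simp only: of_nat_le_iff)
      also have "\<dots> = 2 * (int (w v) + 1)" by simp
      finally have "2 * int ((w v + 1) * degree m v T) \<le> 4 * (int (w v) + 1)" by linarith
      then show ?thesis using r s gap[OF TV T(2)] by linarith
    qed
  qed (use v in auto)
  then obtain M F where c: "M \<union> F = V - {v}" "M \<inter> F = {}" "bounded_on D m w' M" "acyclic_on m F"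
    unfolding wcolorable_def by blast
  have f: "finite M" "finite F" using c(1) fin[of M] fin[of F] by auto
  have nv: "v \<notin> M" "v \<notin> F" using c(1) by (simp_all add: set_eq_iff) blast+
  have VMF: "insert v (M \<union> F) = V" using c(1) v by auto
  have "\<exists>M' F'. M' \<union> F' = insert v (M \<union> F) \<and> M' \<inter> F' = {} \<and> M \<subseteq> M' \<and> F \<subseteq> F' \<and> bounded_on D m w M' \<and> acyclic_on m F'"
  proof (rule wcolorable_insert3[OF m f _ _ c(2-4)])
    show "degree m v (M \<union> F) \<le> 3" using c(1) v dgV by simp
    fix y assume "0 < m v y"
    then show "w y + w v + 1 \<le> w' y" by (cases "m v y") (auto simp: w'_def)
  qed (use nv v in \<open>simp_all add: w'_def\<close>)
  then show False unfolding VMF using finish by blast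
qed

lemma pot_V: "2 * p m w V = (\<Sum>v\<in>V. 2 * a (w v) - k * int (degree m v V))"
proof -
  have "int (2 * edge_count m V) = int (\<Sum>v\<in>V. degree m v V)" using handshake[OF m fV] by simp
  then have "2 * int (edge_count m V) = (\<Sum>v\<in>V. int (degree m v V))" by simp
  then have e: "k * (2 * int (edge_count m V)) = (\<Sum>v\<in>V. k * int (degree m v V))" by (simp add: sum_distrib_left)
  have "2 * p m w V = 2 * (\<Sum>v\<in>V. a (w v)) - k * (2 * int (edge_count m V))"
    by (simp add: pot_def algebra_simps)
  also have "\<dots> = (\<Sum>v\<in>V. 2 * a (w v) - k * int (degree m v V))"
    unfolding e by (simp add: sum_subtractf sum_distrib_left)
  finally show ?thesis .
qed

text \<open>Each vertex contributes at most \<open>-1\<close> to twice the potential of V, which is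
  at least \<open>-2\<close>, so there are at most two vertices. Were one of them light enough for
  M, the other could take F; and two vertices above \<open>D\<close> contribute at most
  \<open>-4\<close>.\<close>

lemma even_False:
  assumes D: "D = 2 * g" and g: "1 \<le> g" and k: "k = 4 * int g + 1"
    and a: "\<And>n. n \<le> g \<Longrightarrow> a n = 8 * int g + 1 - 2 * int n"
      "\<And>n. g < n \<Longrightarrow> n \<le> 2 * g \<Longrightarrow> a n = 8 * int g + 2 - 2 * int n"
  shows False
proof -
  have big: "a n = 4 * int g" if "2 * g < n" for n using a_big[of n] D k that by simp
  have le1: "2 * a (w v) - k * int (degree m v V) \<le> - 1"
    and le2: "D < w v \<Longrightarrow> 2 * a (w v) - k * int (degree m v V) \<le> - 2" if v: "v \<in> V" for v
  proof -
    have mono: "k * int n \<le> k * int (degree m v V)" if "n \<le> degree m v V" for n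
      using that k by (intro int_mult_mono) auto
    show 2: "2 * a (w v) - k * int (degree m v V) \<le> - 2" if "D < w v"
      using big[of "w v"] that mono[of 2] deg2[OF v] k D by simp
    show "2 * a (w v) - k * int (degree m v V) \<le> - 1"
    proof (cases "w v \<le> D")
      case True
      then have d3: "3 \<le> degree m v V" using deg3 v by simp
      show ?thesis
      proof (cases "degree m v V = 3")
        case True
        \<comment> \<open>At \<open>w v = g - 1\<close> the second condition of
          \<open>light_deg3\<close> holds with equality.\<close>
        have "\<not> w v < g"
          using light_deg3[OF v True \<open>w v \<le> D\<close>] a(1)[of "w v"] k by auto
        then show ?thesis
          using True a(1)[of "w v"] a(2)[of "w v"] \<open>w v \<le> D\<close> D k by (cases "w v = g") auto
      next
        case False
        then show ?thesis using mono[of 4] d3 a_le[of "w v"] k by simp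
      qed
    qed (use 2 in simp)
  qed
  have pV: "- 2 \<le> (\<Sum>v\<in>V. 2 * a (w v) - k * int (degree m v V))"
    using potV[of V] V_ne pot_V by auto
  also have "\<dots> \<le> (\<Sum>v\<in>V. - 1)" using le1 by (intro sum_mono)
  finally have "card V \<le> 2" by simp
  moreover have "card V \<noteq> 0" using V_ne fV by simp
  moreover have "card V \<noteq> 1"
    using deg2 m by (auto simp: card_1_singleton_iff degree_insert)
  ultimately have "card V = 2" by linarith
  then obtain x y where xy: "V = {x, y}" "x \<noteq> y" by (auto simp: card_2_iff)
  have Fs: "acyclic_on m {z}" for z using acyclic_on_insert[OF m, of "{}" z] by simp
  have "D < w x"
  proof (rule ccontr)
    assume "\<not> D < w x"
    then have "bounded_on D m w {x}" by (intro bounded_on_sing[OF m]) simp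
    then show False using finish[OF _ _ _ Fs, of "{x}" y] xy by (simp add: insert_commute)
  qed
  moreover have "D < w y"
  proof (rule ccontr)
    assume "\<not> D < w y"
    then have "bounded_on D m w {y}" by (intro bounded_on_sing[OF m]) simp
    then show False using finish[OF _ _ _ Fs, of "{y}" x] xy by (simp add: insert_commute)
  qed
  ultimately have "2 * a (w x) - k * int (degree m x V) \<le> - 2" "2 * a (w y) - k * int (degree m y V) \<le> - 2"
    using le2 xy(1) by simp_all
  then show False using pV xy by simp
qed

end

section \<open>Odd D\<close>

lemma le_mult_pos: "0 < n \<Longrightarrow> b \<le> b * n" for n b :: nat
  by (cases n) auto

locale odd_counterexample = min_counterexample +
  fixes q :: nat
  assumes D: "D = 2 * q + 1" and k: "k = 4 * int q + 4"
    and a: "n \<le> 2 * q + 1 \<Longrightarrow> a n = 8 * int q + 7 - 2 * int n"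
begin

text \<open>The only vertices that contribute positively to the potential when every edge is
  split evenly between its ends.\<close>

definition "P = {v \<in> V. degree m v V = 3 \<and> w v = q}"

lemma aq: "a q = 6 * int q + 7" and aq1: "a (q + 1) = 6 * int q + 5" and a0: "a 0 = 8 * int q + 7"
  using a[of q] a[of "q + 1"] a[of 0] by simp_all

lemma P_D: "v \<in> P \<Longrightarrow> v \<in> V" "v \<in> P \<Longrightarrow> degree m v V = 3" "v \<in> P \<Longrightarrow> w v = q"
  by (simp_all add: P_def)

lemma fP: "finite P"
  using fV by (simp add: P_def)

lemma raise_q: "p m w T - int ((2 * q + 2) * degree m v T) \<le> p m (\<lambda>z. w z + (q + 1) * m v z) T"
  using raise_dg[of T "q + 1" v] by (simp add: algebra_simps)

lemma two_raises:
  assumes "T \<subset> V" "T \<noteq> {}" "t \<le> 2"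
  shows "- 1 \<le> p m w T - int ((2 * q + 2) * t)"
proof -
  have "int ((2 * q + 2) * t) \<le> int ((2 * q + 2) * 2)"
    unfolding of_nat_le_iff using assms(3) by (rule mult_le_mono2)
  then show ?thesis using gap[OF assms(1,2)] k by simp
qed

text \<open>\<open>light_deg3\<close> misses the vertices of P by one, and only for sets that
  receive all three raises. At a double edge to \<open>x\<close> no raise of \<open>x\<close> is
  needed: \<open>v\<close> joins M only when it has at most one edge to M, and then \<open>x\<close>
  is in F.\<close>

lemma P_simple:
  assumes v: "v \<in> P" and x: "x \<in> V"
  shows "m v x \<le> 1"
proof (rule ccontr)
  assume mx: "\<not> m v x \<le> 1"
  then have xv: "x \<noteq> v" using m by (auto simp: mult_fun_def)
  note vV = P_D(1)[OF v] and dv = P_D(2)[OF v] and wv = P_D(3)[OF v]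
  define r where "r = (\<lambda>z. if z = x then 0 else (q + 1) * m v z)"
  define w' where "w' = (\<lambda>z. w z + r z)"
  have dvV: "degree m v (V - {v}) = 3" using dgV[OF vV] dv by simp
  have xV: "x \<in> V - {v}" and fVv: "finite (V - {v})" using x xv fV by auto
  have small: "degree m v (T - {x}) \<le> 1" if "T \<subseteq> V - {v}" for T
    using degree_mono[of "V - {v} - {x}" "T - {x}" m v] degree_remove[OF fVv xV, of m v] dvV mx that fV
    by (simp add: Diff_mono)
  have "wcolorable D m w' (V - {v})"
  proof (rule IHV[OF _ m])
    fix T assume T: "T \<subseteq> V - {v}" "T \<noteq> {}"
    have TV: "T \<subset> V" and fT: "finite T" using T vV fin[of T] by auto
    have "(\<Sum>z\<in>T. r z) = (\<Sum>z\<in>T - {x}. (q + 1) * m v z)"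
      using fT by (intro sum.mono_neutral_cong_right) (auto simp: r_def)
    also have "\<dots> = (q + 1) * degree m v (T - {x})" unfolding degree_def by (rule sum_distrib_left[symmetric])
    finally have "(\<Sum>z\<in>T. r z) \<le> q + 1"
      using mult_le_mono2[OF small[OF T(1)], of "q + 1"] by simp
    then show "- 1 \<le> p m w' T"
      using raise_pot[of m w T r] gap[OF TV T(2)] k unfolding w'_def by linarith
  qed (use vV in auto)
  then obtain M F where c: "M \<union> F = V - {v}" "M \<inter> F = {}" "bounded_on D m w' M" "acyclic_on m F"
    unfolding wcolorable_def by blast
  have f: "finite M" "finite F" and vn: "v \<notin> M" "v \<notin> F" using c(1) fin[of M] fin[of F] by auto
  have s: "degree m v M + degree m v F = 3" using degree_Un[OF f c(2), of m v] c(1) dvV by simp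
  show False
  proof (cases "degree m v F \<le> 1")
    case True
    have "acyclic_on m (insert v F)" using acyclic_on_insert[OF m f(2) vn(2) c(4) True] .
    moreover have "bounded_on D m w M" by (rule bounded_on_mono_weight[OF c(3)]) (simp add: w'_def)
    ultimately show False using finish[of M "insert v F"] c vn vV by auto
  next
    case False
    then have M1: "degree m v M \<le> 1" using s by linarith
    have xM: "x \<notin> M" using degree_ge[OF f(1), of x m v] M1 mx by linarith
    have "bounded_on D m w (insert v M)"
    proof (rule bounded_on_insert[OF m f(1) vn(1) c(3) M1])
      fix y assume "y \<in> M" "0 < m v y"
      then show "w y + w v + 1 \<le> w' y"
        using xM le_mult_pos[of "m v y" "q + 1"] wv by (auto simp: w'_def r_def)
    qed (use wv D in \<open>simp_all add: w'_def\<close>)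
    then show False using finish[of "insert v M" F] c vn vV by auto
  qed
qed

text \<open>With both vertices deleted only two raises for \<open>v1\<close> remain, and the gap
  covers them. \<open>v2\<close> returns first, while its weight is raised to
  \<open>q + (q + 1) = D\<close>: this still admits it to M as a single vertex if both its other
  edges go to F.\<close>

lemma P_indep:
  assumes v: "v1 \<in> P" "v2 \<in> P"
  shows "m v1 v2 = 0"
proof (rule ccontr)
  assume "m v1 v2 \<noteq> 0"
  then have m12: "m v1 v2 = 1" using P_simple[OF v(1) P_D(1)[OF v(2)]] by simp
  then have ne: "v1 \<noteq> v2" by auto
  note V = P_D(1)[OF v(1)] P_D(1)[OF v(2)] and w = P_D(3)[OF v(1)] P_D(3)[OF v(2)]
  define W where "W = V - {v1, v2}"
  have d: "degree m v1 W = 2" "degree m v2 W = 2"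
  proof -
    have "V - {v1} - {v2} = W" "V - {v2} - {v1} = W" by (auto simp: W_def)
    then show "degree m v1 W = 2" "degree m v2 W = 2"
      using degree_remove[of "V - {v1}" v2 m v1] degree_remove[of "V - {v2}" v1 m v2] dgV[OF V(1)] dgV[OF V(2)]
        P_D(2)[OF v(1)] P_D(2)[OF v(2)] m12 msym[of v1 v2] fV V ne by auto
  qed
  define w' where "w' = (\<lambda>z. w z + (q + 1) * m v1 z)"
  have "wcolorable D m w' W"
  proof (rule IHV[OF _ m])
    fix T assume T: "T \<subseteq> W" "T \<noteq> {}"
    have "degree m v1 T \<le> 2" using degree_mono[of W T m v1] T d fV by (simp add: W_def)
    then show "- 1 \<le> p m w' T"
      using raise_q[of T v1] two_raises[of T "degree m v1 T"] T V unfolding w'_def W_def by force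
  qed (use V in \<open>auto simp: W_def\<close>)
  then obtain M F where c: "M \<union> F = W" "M \<inter> F = {}" "bounded_on D m w' M" "acyclic_on m F"
    unfolding wcolorable_def by blast
  have f: "finite M" "finite F" and vn: "v1 \<notin> M" "v1 \<notin> F" "v2 \<notin> M" "v2 \<notin> F"
    using c(1) fin[of M] fin[of F] by (auto simp: W_def)
  have s: "degree m v2 M + degree m v2 F = 2" using degree_Un[OF f c(2), of m v2] c(1) d by simp
  have "\<exists>M' F'. M' \<union> F' = insert v2 W \<and> M' \<inter> F' = {} \<and> bounded_on D m w' M' \<and> acyclic_on m F'"
  proof (cases "degree m v2 F \<le> 1")
    case True
    have "acyclic_on m (insert v2 F)" using acyclic_on_insert[OF m f(2) vn(4) c(4) True] .
    then show ?thesis using c vn by (intro exI[of _ M] exI[of _ "insert v2 F"]) auto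
  next
    case False
    then have d0: "degree m v2 M = 0" using s by linarith
    have "bounded_on D m w' (insert v2 M)"
    proof (rule bounded_on_insert[OF m f(1) vn(3) c(3)])
      show "w' v2 \<le> D" using w m12 D by (simp add: w'_def)
      fix y assume "y \<in> M" "0 < m v2 y"
      then show "w' y + w' v2 + 1 \<le> w' y" using d0 degree_ge[OF f(1), of y m v2] by simp
    qed (use d0 in auto)
    then show ?thesis using c vn by (intro exI[of _ "insert v2 M"] exI[of _ F]) auto
  qed
  then obtain M' F' where c': "M' \<union> F' = insert v2 W" "M' \<inter> F' = {}" "bounded_on D m w' M'" "acyclic_on m F'" by blast
  have "finite (M' \<union> F')" "v1 \<notin> M' \<union> F'" unfolding c'(1) using fV ne by (auto simp: W_def)
  then have f': "finite M'" "finite F'" and vn': "v1 \<notin> M'" "v1 \<notin> F'" by auto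
  have VMF: "insert v1 (M' \<union> F') = V" unfolding c'(1) using V by (auto simp: W_def)
  have "\<exists>M F. M \<union> F = insert v1 (M' \<union> F') \<and> M \<inter> F = {} \<and> M' \<subseteq> M \<and> F' \<subseteq> F \<and> bounded_on D m w M \<and> acyclic_on m F"
  proof (rule wcolorable_insert3[OF m f' vn' c'(2-4)])
    have "degree m v1 (M' \<union> F') \<le> degree m v1 V" using VMF by (intro degree_mono[OF fV]) auto
    then show "degree m v1 (M' \<union> F') \<le> 3" using P_D(2)[OF v(1)] by simp
    fix y assume "0 < m v1 y"
    then show "w y + w v1 + 1 \<le> w' y" using le_mult_pos[of "m v1 y" "q + 1"] w by (simp add: w'_def)
  qed (use w D in \<open>simp_all add: w'_def\<close>)
  then show False unfolding VMF using finish by blast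
qed

text \<open>Once \<open>v\<close> is deleted, \<open>u\<close> has at most one edge left and can
  always return to F, the only place for it. Only the other edges of \<open>v\<close>, at most two,
  call for raises.\<close>

lemma deg2_no_P:
  assumes u: "u \<in> V" "degree m u V = 2" "D < w u" and v: "v \<in> P"
  shows "m u v = 0"
proof (rule ccontr)
  assume muv: "m u v \<noteq> 0"
  note vV = P_D(1)[OF v] and wv = P_D(3)[OF v]
  have ne: "u \<noteq> v" using muv by auto
  define W where "W = V - {u, v}"
  have dv: "degree m v W \<le> 2" and du: "degree m u W \<le> 1"
  proof -
    have "V - {u} - {v} = W" "V - {v} - {u} = W" by (auto simp: W_def)
    then show "degree m v W \<le> 2" "degree m u W \<le> 1"
      using degree_remove[of "V - {u}" v m u] degree_remove[of "V - {v}" u m v] dgV[OF u(1)] dgV[OF vV]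
        P_D(2)[OF v] u(2) muv msym[of u v] fV u(1) vV ne by auto
  qed
  define w' where "w' = (\<lambda>z. w z + (q + 1) * m v z)"
  have "wcolorable D m w' W"
  proof (rule IHV[OF _ m])
    fix T assume T: "T \<subseteq> W" "T \<noteq> {}"
    have "degree m v T \<le> 2" using degree_mono[of W T m v] T dv fV by (simp add: W_def)
    then show "- 1 \<le> p m w' T"
      using raise_q[of T v] two_raises[of T "degree m v T"] T vV unfolding w'_def W_def by force
  qed (use vV in \<open>auto simp: W_def\<close>)
  then obtain M F where c: "M \<union> F = W" "M \<inter> F = {}" "bounded_on D m w' M" "acyclic_on m F"
    unfolding wcolorable_def by blast
  have f: "finite M" "finite F" and vn: "u \<notin> M" "u \<notin> F" "v \<notin> M" "v \<notin> F"
    using c(1) fin[of M] fin[of F] by (auto simp: W_def)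
  have "F \<subseteq> W" "finite W" using c(1) fV by (auto simp: W_def)
  then have "degree m u F \<le> 1" using degree_mono[of W F m u] du by simp
  then have F': "acyclic_on m (insert u F)" using acyclic_on_insert[OF m f(2) vn(2) c(4)] by simp
  have VMF: "insert v (M \<union> insert u F) = V" using c(1) u vV by (auto simp: W_def)
  have "\<exists>M' F'. M' \<union> F' = insert v (M \<union> insert u F) \<and> M' \<inter> F' = {} \<and> M \<subseteq> M' \<and> insert u F \<subseteq> F' \<and> bounded_on D m w M' \<and> acyclic_on m F'"
  proof (rule wcolorable_insert3[OF m f(1) _ vn(3) _ _ c(3) F'])
    have "degree m v (M \<union> insert u F) \<le> degree m v V" using VMF by (intro degree_mono[OF fV]) auto
    then show "degree m v (M \<union> insert u F) \<le> 3" using P_D(2)[OF v] by simp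
    fix y assume "0 < m v y"
    then show "w y + w v + 1 \<le> w' y" using le_mult_pos[of "m v y" "q + 1"] wv by (simp add: w'_def)
  qed (use wv D f vn ne c(2) in \<open>simp_all add: w'_def\<close>)
  then show False unfolding VMF using finish by blast
qed

end

lemma card_ge2: "finite A \<Longrightarrow> x \<in> A \<Longrightarrow> y \<in> A \<Longrightarrow> x \<noteq> y \<Longrightarrow> 2 \<le> card A"
  using card_mono[of A "{x, y}"] by simp

section \<open>Vertices with several neighbours in P\<close>

context odd_counterexample
begin

lemma degree_split: "R \<subseteq> V \<Longrightarrow> degree m v V = degree m v R + degree m v (V - R)"
  using degree_Un[of R "V - R" m v] fV fin[of R] by (simp add: Un_absorb1)

lemma degree_W: "T \<subseteq> W \<Longrightarrow> W \<subseteq> V \<Longrightarrow> degree m v T \<le> degree m v W"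
  by (rule degree_mono[OF fin])

lemma P_sym_simple:
  assumes "v \<in> P" "x \<in> V" "0 < m x v"
  shows "m v x = 1" "m x v = 1"
  using P_simple[OF assms(1,2)] assms(3) msym[of x v] by auto

lemma pot_insert_P:
  assumes "v \<in> P" "v \<notin> T" "T \<subseteq> V"
  shows "p m w (insert v T) = p m w T + 6 * int q + 7 - k * int (degree m v T)"
  using pot_insert[OF m fin[OF assms(3)] assms(2)] P_D(3)[OF assms(1)] aq by simp

text \<open>Adding \<open>v\<close> to T gives a proper set of at least two vertices, so
  \<open>gap2\<close> bounds its potential by \<open>k\<close>; removing \<open>v\<close> again
  yields \<open>k - (6 * q + 7) + 2 * k\<close>.\<close>

lemma two_P_neighbours:
  assumes T: "T \<subset> V" "T \<noteq> {}" and v: "v \<in> P" "v \<notin> T" "insert v T \<noteq> V" and d: "degree m v T = 2"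
  shows "6 * int q + 5 \<le> p m w T"
proof -
  have "insert v T \<subset> V" using T v P_D(1)[OF v(1)] by auto
  moreover obtain t where "t \<in> T" using T by auto
  then have "2 \<le> card (insert v T)" using T v fin[of T] by (intro card_ge2[of _ v t]) auto
  ultimately have "k \<le> p m w (insert v T)" by (rule gap2)
  then show ?thesis using pot_insert_P[OF v(1,2)] T d k by simp
qed

text \<open>Delete \<open>u\<close>, \<open>v1\<close> and \<open>v2\<close> and raise the remaining
  neighbours of \<open>v1\<close> and \<open>v2\<close>. On the way back \<open>u\<close>, with one
  edge left, goes to F; then \<open>v1\<close> and \<open>v2\<close> return by
  \<open>wcolorable_insert3\<close>, each using up its own raises.\<close>

lemma deg3_one_P:
  assumes u: "u \<in> V" "degree m u V = 3" "w u = q + 1"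
    and v: "v1 \<in> P" "v2 \<in> P" "v1 \<noteq> v2" and e: "0 < m u v1" "0 < m u v2"
  shows False
proof -
  note V = P_D(1)[OF v(1)] P_D(1)[OF v(2)] and wv = P_D(3)[OF v(1)] P_D(3)[OF v(2)]
  have uP: "u \<notin> P" using u by (auto simp: P_def)
  then have ne: "u \<noteq> v1" "u \<noteq> v2" using v by auto
  note e1 = P_sym_simple[OF v(1) u(1) e(1)] and e2 = P_sym_simple[OF v(2) u(1) e(2)]
  note i = P_indep[OF v(1,2)] P_indep[OF v(2,1)]
  define R where "R = {u, v1, v2}"
  define W where "W = V - R"
  have RV: "R \<subseteq> V" using u V by (auto simp: R_def)
  have WV: "W \<subseteq> V" by (auto simp: W_def)
  have d: "degree m v1 W = 2" "degree m v2 W = 2" "degree m u W = 1"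
    using degree_split[OF RV, of v1] degree_split[OF RV, of v2] degree_split[OF RV, of u] ne v(3) i e1 e2 u
      P_D(2)[OF v(1)] P_D(2)[OF v(2)]
    unfolding W_def[symmetric] by (simp_all add: R_def degree_insert)
  define r where "r = (\<lambda>z. (q + 1) * m v1 z + (q + 1) * m v2 z)"
  define w' where "w' = (\<lambda>z. w z + r z)"
  have "wcolorable D m w' W"
  proof (rule IHV[OF _ m])
    fix T assume T: "T \<subseteq> W" "T \<noteq> {}"
    have TV: "T \<subset> V" and nT: "u \<notin> T" "v1 \<notin> T" "v2 \<notin> T" using T u by (auto simp: W_def R_def)
    have t: "degree m v1 T \<le> 2" "degree m v2 T \<le> 2" "degree m u T \<le> 1"
      using degree_W[OF T(1) WV] d by metis+
    have "(\<Sum>z\<in>T. r z) = (q + 1) * (degree m v1 T + degree m v2 T)"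
      by (simp add: r_def degree_def sum.distrib sum_distrib_left algebra_simps)
    then have cost: "p m w T - int ((2 * q + 2) * (degree m v1 T + degree m v2 T)) \<le> p m w' T"
      using raise_pot[of m w T r] unfolding w'_def by (simp add: algebra_simps)
    have ins: "insert v1 T \<noteq> V" "insert v2 T \<noteq> V" using nT u ne by auto
    show "- 1 \<le> p m w' T"
    proof (cases "degree m v1 T + degree m v2 T \<le> 2")
      case True
      then show ?thesis using two_raises[OF TV T(2) True] cost by linarith
    next
      case False
      have p65: "6 * int q + 5 \<le> p m w T"
        using False t two_P_neighbours[OF TV T(2) v(1) nT(2) ins(1)] two_P_neighbours[OF TV T(2) v(2) nT(3) ins(2)]
        by linarith
      show ?thesis
      proof (cases "degree m v1 T + degree m v2 T = 3")
        case True
        then show ?thesis using cost p65 unfolding True by simp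
      next
        case False
        \<comment> \<open>Four raises cost \<open>2 * k\<close>. They are covered by the potential
          of T with all three deleted vertices: either that set is proper and \<open>gap2\<close>
          applies, or it is V and the last edge of \<open>u\<close> ends in T as well.\<close>
        then have t4: "degree m v1 T = 2" "degree m v2 T = 2" using \<open>\<not> _ \<le> 2\<close> t by linarith+
        let ?T1 = "insert v1 T" and ?T2 = "insert v2 (insert v1 T)"
        let ?T3 = "insert u ?T2"
        have sub: "?T1 \<subseteq> V" "?T2 \<subseteq> V" "?T3 \<subseteq> V" using TV V u by auto
        have fT: "finite T" using TV fin by auto
        have "p m w ?T1 = p m w T + 6 * int q + 7 - k * 2"
          using pot_insert_P[OF v(1) nT(2)] TV t4 by simp
        moreover have "p m w ?T2 = p m w ?T1 + 6 * int q + 7 - k * 2"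
          using pot_insert_P[OF v(2) _ sub(1)] nT v(3) t4 i fT by (simp add: degree_insert)
        moreover have "p m w ?T3 = p m w ?T2 + 6 * int q + 5 - k * (2 + int (degree m u T))"
          using pot_insert[OF m fin[OF sub(2)], of u a k w] nT ne v(3) e1 e2 u aq1 fT
          by (simp add: degree_insert algebra_simps)
        moreover have "k - k * int (degree m u T) - 1 \<le> p m w ?T3"
        proof (cases "degree m u T = 1")
          case True
          then show ?thesis using potV[OF sub(3)] by simp
        next
          case False
          then have "degree m u T = 0" using t by simp
          have "?T3 \<noteq> V"
          proof
            assume "?T3 = V"
            then have "T = W" using nT ne v(3) by (auto simp: W_def R_def)
            then show False using \<open>degree m u T = 0\<close> d by simp
          qed
          with sub(3) have "?T3 \<subset> V" by (rule psubsetI)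
          moreover have "2 \<le> card ?T3" using fT v(3) by (intro card_ge2[of _ v1 v2]) auto
          ultimately have "k \<le> p m w ?T3" by (rule gap2)
          then show ?thesis using \<open>degree m u T = 0\<close> by simp
        qed
        ultimately show ?thesis using cost t4 k by (simp add: algebra_simps)
      qed
    qed
  qed (use u in \<open>auto simp: W_def R_def\<close>)
  then obtain M F where c: "M \<union> F = W" "M \<inter> F = {}" "bounded_on D m w' M" "acyclic_on m F"
    unfolding wcolorable_def by blast
  have FW: "F \<subseteq> W" "M \<subseteq> W" using c(1) by auto
  then have f: "finite M" "finite F" using WV fin[of M] fin[of F] by auto
  have "u \<notin> W" "v1 \<notin> W" "v2 \<notin> W" by (simp_all add: W_def R_def)
  then have vn: "u \<notin> M" "u \<notin> F" "v1 \<notin> M" "v1 \<notin> F" "v2 \<notin> M" "v2 \<notin> F" using FW by auto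
  have "degree m u F \<le> 1" using degree_W[OF FW(1) WV] d by metis
  then have F': "acyclic_on m (insert u F)" using acyclic_on_insert[OF m f(2) vn(2) c(4)] by simp
  define w1 where "w1 = (\<lambda>z. w z + (q + 1) * m v2 z)"
  have UV: "insert v2 (insert v1 (M \<union> insert u F)) = V" using c(1) u V RV by (auto simp: W_def R_def)
  then have sV: "insert v1 (M \<union> insert u F) \<subseteq> V" by auto
  have "\<exists>M' F'. M' \<union> F' = insert v1 (M \<union> insert u F) \<and> M' \<inter> F' = {} \<and> M \<subseteq> M' \<and> insert u F \<subseteq> F' \<and> bounded_on D m w1 M' \<and> acyclic_on m F'"
  proof (rule wcolorable_insert3[OF m f(1) _ vn(3) _ _ c(3) F'])
    have "degree m v1 (M \<union> insert u F) \<le> degree m v1 V" using sV by (intro degree_W) auto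
    then show "degree m v1 (M \<union> insert u F) \<le> 3" using P_D(2)[OF v(1)] by simp
    fix y assume "0 < m v1 y"
    then show "w1 y + w1 v1 + 1 \<le> w' y"
      using le_mult_pos[of "m v1 y" "q + 1"] wv i by (simp add: w'_def w1_def r_def)
  qed (use wv D f vn ne c(2) i in \<open>simp_all add: w'_def w1_def r_def\<close>)
  then obtain M' F' where c': "M' \<union> F' = insert v1 (M \<union> insert u F)" "M' \<inter> F' = {}" "bounded_on D m w1 M'" "acyclic_on m F'"
    by blast
  have vn': "v2 \<notin> M' \<union> F'" unfolding c'(1) using vn ne v(3) by auto
  have f': "finite M'" "finite F'" using f finite_Un[of M' F'] unfolding c'(1) by auto
  have "\<exists>M'' F''. M'' \<union> F'' = insert v2 (M' \<union> F') \<and> M'' \<inter> F'' = {} \<and> M' \<subseteq> M'' \<and> F' \<subseteq> F'' \<and> bounded_on D m w M'' \<and> acyclic_on m F''"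
  proof (rule wcolorable_insert3[OF m f' _ _ c'(2-4)])
    have "degree m v2 (M' \<union> F') \<le> degree m v2 V" using sV unfolding c'(1) by (intro degree_W) auto
    then show "degree m v2 (M' \<union> F') \<le> 3" using P_D(2)[OF v(2)] by simp
    fix y assume "0 < m v2 y"
    then show "w y + w v2 + 1 \<le> w1 y"
      using le_mult_pos[of "m v2 y" "q + 1"] wv by (simp add: w1_def)
  qed (use wv D vn' in \<open>simp_all add: w1_def\<close>)
  then show False unfolding c'(1) UV using finish by blast
qed


lemma P_two_neighbours:
  assumes v: "v \<in> P" and W: "W \<subseteq> V" and d: "degree m v W = 2"
  obtains x y where "x \<noteq> y" "x \<in> W" "y \<in> W"
    "\<And>T. T \<subseteq> W \<Longrightarrow> degree m v T = (if x \<in> T then 1 else 0) + (if y \<in> T then 1 else 0)"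
proof -
  have dT: "degree m v T = card {z \<in> T. 0 < m v z}" if "T \<subseteq> W" for T
  proof -
    have fT: "finite T" using that W fin[of T] by auto
    have "m v z = (if 0 < m v z then 1 else 0)" if "z \<in> T" for z
      using P_simple[OF v, of z] that \<open>T \<subseteq> W\<close> W by auto
    then have "degree m v T = (\<Sum>z\<in>T. if 0 < m v z then 1 else 0)" unfolding degree_def by (intro sum.cong) auto
    also have "\<dots> = card {z \<in> T. 0 < m v z}" using fT by (simp add: sum.If_cases Int_def)
    finally show ?thesis .
  qed
  obtain x y where xy: "{z \<in> W. 0 < m v z} = {x, y}" "x \<noteq> y"
    using dT[of W] d by (auto simp: card_2_iff)
  have "degree m v T = (if x \<in> T then 1 else 0) + (if y \<in> T then 1 else 0)" if T: "T \<subseteq> W" for T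
  proof -
    have "{z \<in> T. 0 < m v z} = T \<inter> {x, y}" using xy T by auto
    then show ?thesis using dT[OF T] xy(2) by (auto simp: Int_insert_right)
  qed
  then show thesis using that xy by blast
qed

text \<open>T together with \<open>v1\<close>, \<open>v2\<close> and \<open>u\<close> has potential
  at least \<open>k\<close>, because \<open>v3\<close> keeps this set proper. Removing the three
  vertices gives back six edges and those from \<open>u\<close> to T.\<close>

lemma star_pair:
  assumes u: "u \<in> V" "w u = 0" "u \<notin> P" and v: "v1 \<in> P" "v2 \<in> P" "v1 \<noteq> v2" and e: "0 < m u v1" "0 < m u v2"
    and T: "T \<subseteq> V" "u \<notin> T" "v1 \<notin> T" "v2 \<notin> T" and v3: "v3 \<in> V" "v3 \<notin> insert u (insert v1 (insert v2 T))"
    and d: "degree m v1 T = 2" "degree m v2 T = 2"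
  shows "8 * int q + 7 + k * int (degree m u T) \<le> p m w T"
proof -
  note V = P_D(1)[OF v(1)] P_D(1)[OF v(2)]
  have ne: "u \<noteq> v1" "u \<noteq> v2" using u v by auto
  note e1 = P_sym_simple[OF v(1) u(1) e(1)] and e2 = P_sym_simple[OF v(2) u(1) e(2)]
  note i = P_indep[OF v(1,2)] P_indep[OF v(2,1)]
  let ?T1 = "insert v1 T" and ?T2 = "insert v2 (insert v1 T)"
  let ?T3 = "insert u ?T2"
  have sub: "?T1 \<subseteq> V" "?T2 \<subseteq> V" "?T3 \<subseteq> V" using T V u by auto
  have fT: "finite T" using T fin by auto
  have "p m w ?T1 = p m w T + 6 * int q + 7 - k * 2"
    using pot_insert_P[OF v(1) T(3,1)] d by simp
  moreover have "p m w ?T2 = p m w ?T1 + 6 * int q + 7 - k * 2"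
    using pot_insert_P[OF v(2) _ sub(1)] T v(3) d i fT by (simp add: degree_insert)
  moreover have "p m w ?T3 = p m w ?T2 + 8 * int q + 7 - k * (2 + int (degree m u T))"
    using pot_insert[OF m fin[OF sub(2)], of u a k w] T ne v(3) e1 e2 u a0 fT
    by (simp add: degree_insert algebra_simps)
  moreover have "k \<le> p m w ?T3"
  proof (rule gap2)
    show "?T3 \<subset> V" using sub(3) v3 by auto
    show "2 \<le> card ?T3" using fT v(3) by (intro card_ge2[of _ v1 v2]) auto
  qed
  ultimately show ?thesis using k by (simp add: algebra_simps)
qed

text \<open>In the coloured rest of the graph the edges between the two neighbours of \<open>v1\<close> and between those
  of \<open>v2\<close> are added, so that \<open>v1\<close> and \<open>v2\<close> can go to F by subdividing them. The weight of \<open>c\<close> is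
  raised so that \<open>u\<close> can go to M, together with \<open>v3\<close> if necessary.\<close>

lemma deg4_three_P_aux:
  assumes u: "u \<in> V" "degree m u V = 4" "w u = 0"
    and v: "v1 \<in> P" "v2 \<in> P" "v3 \<in> P" and vd: "v1 \<noteq> v2" "v1 \<noteq> v3" "v2 \<noteq> v3"
    and e: "0 < m u v1" "0 < m u v2" "0 < m u v3"
    and W: "W = V - {u, v1, v2, v3}" and c: "c \<in> W" "0 < m u c"
    and good: "\<And>v T. v = v1 \<or> v = v2 \<Longrightarrow> T \<subseteq> W \<Longrightarrow> c \<in> T \<Longrightarrow> degree m v T = 2 \<Longrightarrow> 6 * int q + 7 \<le> p m w T"
  shows False
proof -
  note V = P_D(1)[OF v(1)] P_D(1)[OF v(2)] P_D(1)[OF v(3)]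
  have uP: "u \<notin> P" using u by (auto simp: P_def)
  then have ne: "u \<noteq> v1" "u \<noteq> v2" "u \<noteq> v3" using v by auto
  note es = P_sym_simple[OF v(1) u(1) e(1)] P_sym_simple[OF v(2) u(1) e(2)] P_sym_simple[OF v(3) u(1) e(3)]
  note i = P_indep[OF v(1,2)] P_indep[OF v(2,1)] P_indep[OF v(1,3)] P_indep[OF v(3,1)] P_indep[OF v(2,3)] P_indep[OF v(3,2)]
  have RV: "{u, v1, v2, v3} \<subseteq> V" using u V by auto
  have WV: "W \<subseteq> V" and nW: "u \<notin> W" "v1 \<notin> W" "v2 \<notin> W" "v3 \<notin> W" by (auto simp: W)
  have d: "degree m v1 W = 2" "degree m v2 W = 2" "degree m v3 W = 2" "degree m u W = 1"
    using degree_split[OF RV, of v1] degree_split[OF RV, of v2] degree_split[OF RV, of v3] degree_split[OF RV, of u]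
      ne vd i es u P_D(2)[OF v(1)] P_D(2)[OF v(2)] P_D(2)[OF v(3)]
    unfolding W[symmetric] by (simp_all add: degree_insert)
  obtain x1 y1 where 1: "x1 \<noteq> y1" "x1 \<in> W" "y1 \<in> W"
    "\<And>T. T \<subseteq> W \<Longrightarrow> degree m v1 T = (if x1 \<in> T then 1 else 0) + (if y1 \<in> T then 1 else 0)"
    using P_two_neighbours[OF v(1) WV d(1)] by blast
  obtain x2 y2 where 2: "x2 \<noteq> y2" "x2 \<in> W" "y2 \<in> W"
    "\<And>T. T \<subseteq> W \<Longrightarrow> degree m v2 T = (if x2 \<in> T then 1 else 0) + (if y2 \<in> T then 1 else 0)"
    using P_two_neighbours[OF v(2) WV d(2)] by blast
  define m2 where "m2 = add_edge x2 y2 m"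
  define m12 where "m12 = add_edge x1 y1 m2"
  \<comment> \<open>In M the vertex \<open>u\<close> shall be treated as having weight
    \<open>q + 1\<close>, room for a pendant \<open>v3\<close> of weight \<open>q\<close> and its
    edge; one more unit is for the edge \<open>u c\<close>.\<close>
  define w' where "w' = w(c := w c + (q + 2))"
  have m2m: "mult_fun m2" "mult_fun m12"
    unfolding m2_def m12_def using m 1(1) 2(1) by (auto intro!: mult_fun_add_edge)
  have "wcolorable D m12 w' W"
  proof (rule IHV[OF _ m2m(2)])
    show "W \<subset> V" using u(1) WV nW by auto
    fix T assume T: "T \<subseteq> W" "T \<noteq> {}"
    have TV: "T \<subset> V" and TV': "T \<subseteq> V" and nT: "u \<notin> T" "v1 \<notin> T" "v2 \<notin> T" "v3 \<notin> T"
      using T WV nW u(1) by auto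
    have fT: "finite T" using fin[OF TV'] .
    \<comment> \<open>An added edge is charged exactly to the sets containing both its ends, that
      is, both remaining neighbours of \<open>v1\<close> or of \<open>v2\<close>.\<close>
    define n1 n2 where "n1 = (if degree m v1 T = 2 then k else 0)" and "n2 = (if degree m v2 T = 2 then k else 0)"
    have pm: "p m12 w' T = p m w' T - n1 - n2"
      unfolding m12_def using pot_add_edge[OF m2m(1) fT 1(1)] pot_add_edge[OF m fT 2(1)] 1(4)[OF T(1)] 2(4)[OF T(1)]
      by (auto simp: m2_def n1_def n2_def split: if_splits)
    have one: "6 * int q + 5 \<le> p m w T" if "degree m v1 T = 2 \<or> degree m v2 T = 2"
      using that
    proof
      assume "degree m v1 T = 2"
      then show ?thesis using nT ne u(1) by (intro two_P_neighbours[OF TV T(2) v(1)]) auto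
    next
      assume "degree m v2 T = 2"
      then show ?thesis using nT ne u(1) by (intro two_P_neighbours[OF TV T(2) v(2)]) auto
    qed
    have two: "8 * int q + 7 + k * int (degree m u T) \<le> p m w T" if "degree m v1 T = 2" "degree m v2 T = 2"
      by (rule star_pair[OF u(1,3) uP v(1,2) vd(1) e(1,2) TV' nT(1-3) V(3) _ that])
        (use nT ne vd in auto)
    show "- 1 \<le> p m12 w' T"
    proof (cases "c \<in> T")
      case False
      then have "p m w' T = p m w T" by (auto simp: pot_def w'_def intro!: sum.cong)
      moreover have "8 * int q + 7 \<le> p m w T" if "degree m v1 T = 2" "degree m v2 T = 2"
      proof -
        have "0 \<le> k * int (degree m u T)" using k by simp
        then show ?thesis using two[OF that] by linarith
      qed
      moreover have "- 1 \<le> p m w T" by (rule potV[OF TV' T(2)])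
      ultimately show ?thesis using one pm k by (auto simp: n1_def n2_def split: if_splits)
    next
      case True
      have "p m w T \<le> p m w' T + (\<Sum>z\<in>T. if z = c then 2 * int (q + 2) else 0)"
        by (rule pot_raise) (use a_step[of "w c" "q + 2"] in \<open>simp add: w'_def\<close>)
      then have cost: "p m w T \<le> p m w' T + 2 * int q + 4" using fT True by (simp add: sum.delta)
      show ?thesis
      proof (cases "T = {c}")
        case True
        then have "degree m v1 T \<noteq> 2" "degree m v2 T \<noteq> 2"
          using P_simple[OF v(1), of c] P_simple[OF v(2), of c] c(1) WV by (auto simp: degree_insert)
        then show ?thesis using True pm a_ge[of "w' c"] k m by (simp add: n1_def n2_def)
      next
        case False
        then obtain z where "z \<in> T" "z \<noteq> c" using True by auto
        then have "k \<le> p m w T" using True fT by (intro gap2[OF TV] card_ge2[of _ c z]) auto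
        moreover have "12 * int q + 11 \<le> p m w T" if "degree m v1 T = 2" "degree m v2 T = 2"
        proof -
          have "1 \<le> degree m u T" using degree_ge[OF fT True, of m u] c(2) by linarith
          then have "k * int 1 \<le> k * int (degree m u T)" using k by (intro int_mult_mono) auto
          then have "k \<le> k * int (degree m u T)" by (simp only: of_nat_1 mult_1_right)
          then show ?thesis using two[OF that] k by linarith
        qed
        \<comment> \<open>\<open>6 * q + 7\<close> is \<open>k + 2 * (q + 2) - 1\<close>: one added
          edge and the raise of \<open>c\<close> leave exactly \<open>-1\<close>. This is where the
          bound in \<open>good\<close> comes from.\<close>
        moreover have "6 * int q + 7 \<le> p m w T" if "degree m v1 T = 2 \<or> degree m v2 T = 2"
          using that good T(1) True by blast
        ultimately show ?thesis using pm k cost by (auto simp: n1_def n2_def split: if_splits)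
      qed
    qed
  qed
  then obtain M F where wcolorable: "M \<union> F = W" "M \<inter> F = {}" "bounded_on D m12 w' M" "acyclic_on m12 F"
    unfolding wcolorable_def by blast
  have sub: "M \<subseteq> W" "F \<subseteq> W" using wcolorable(1) by auto
  then have f: "finite M" "finite F" using WV fin[of M] fin[of F] by auto
  have vn: "u \<notin> M" "u \<notin> F" "v1 \<notin> M" "v1 \<notin> F" "v2 \<notin> M" "v2 \<notin> F" "v3 \<notin> M" "v3 \<notin> F"
    using sub nW by auto
  have m2v: "m2 z t = m z t" if "z \<notin> W" for z t
    using that 2(2,3) by (auto simp: m2_def add_edge_def doubleton_eq_iff)
  have m12v: "m12 z t = m z t" if "z \<notin> W" for z t
    using that 1(2,3) m2v by (auto simp: m12_def add_edge_def doubleton_eq_iff)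
  have dg12: "degree m12 z A = degree m z A" if "z \<notin> W" for z A
    using m12v[OF that] by (simp add: degree_def)
  have dg2: "degree m2 z A = degree m z A" if "z \<notin> W" for z A
    using m2v[OF that] by (simp add: degree_def)
  define w1 where "w1 = w(u := q + 1)"
  have M1: "bounded_on D m12 w1 (insert u M)"
  proof (rule bounded_on_insert[OF m2m(2) f(1) vn(1) wcolorable(3)])
    show "degree m12 u M \<le> 1" using dg12[OF nW(1)] degree_W[OF sub(1) WV, of u] d(4) by simp
    show "w1 u \<le> D" using D by (simp add: w1_def)
    fix y assume y: "y \<in> M"
    then show "w1 y \<le> w' y" using vn(1) by (auto simp: w1_def w'_def)
    assume "0 < m12 u y"
    then have "0 < m u y" using m12v[OF nW(1)] by simp
    have "y = c"
    proof (rule ccontr)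
      assume "y \<noteq> c"
      then have "m u c + m u y \<le> degree m u W"
        using degree_remove[OF fin[OF WV] c(1), of m u] degree_ge[of "W - {c}" y m u] y sub(1) fin[OF WV] by auto
      then show False using d(4) c(2) \<open>0 < m u y\<close> by linarith
    qed
    then show "w1 y + w1 u + 1 \<le> w' y" using y vn(1) by (auto simp: w1_def w'_def)
  qed
  have s3: "degree m v3 M + degree m v3 F = 2" using degree_Un[OF f wcolorable(2), of m v3] wcolorable(1) d(3) by simp
  have "\<exists>M3 F3. M3 \<union> F3 = insert v3 (insert u W) \<and> M3 \<inter> F3 = {} \<and> F3 \<subseteq> insert v3 F \<and> bounded_on D m12 w M3 \<and> acyclic_on m12 F3"
  proof (cases "degree m v3 F \<le> 1")
    case True
    then have "acyclic_on m12 (insert v3 F)"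
      using dg12[OF nW(4)] by (intro acyclic_on_insert[OF m2m(2) f(2) vn(8) wcolorable(4)]) simp
    moreover have "bounded_on D m12 w (insert u M)"
      by (rule bounded_on_mono_weight[OF M1]) (use u(3) in \<open>simp add: w1_def\<close>)
    ultimately show ?thesis
      using wcolorable(1,2) vn ne by (intro exI[of _ "insert u M"] exI[of _ "insert v3 F"]) auto
  next
    case False
    \<comment> \<open>Both remaining edges of \<open>v3\<close> go to F, so \<open>u\<close> is its
      only neighbour in M.\<close>
    then have d0: "degree m v3 M = 0" using s3 by linarith
    have "bounded_on D m12 w (insert v3 (insert u M))"
    proof (rule bounded_on_insert[OF m2m(2) _ _ M1])
      show "degree m12 v3 (insert u M) \<le> 1"
        using dg12[OF nW(4)] d0 es vn(1) f by (simp add: degree_insert)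
      show "w v3 \<le> D" using D P_D(3)[OF v(3)] by simp
      fix y assume y: "y \<in> insert u M" 
      show "w y \<le> w1 y" using u(3) by (simp add: w1_def)
      assume "0 < m12 v3 y"
      then have "y = u" using y m12v[OF nW(4)] degree_ge[OF f(1), of y m v3] d0 by auto
      then show "w y + w v3 + 1 \<le> w1 y" using u(3) P_D(3)[OF v(3)] by (simp add: w1_def)
    qed (use f vn ne in auto)
    then show ?thesis
      using wcolorable(1,2,4) vn ne by (intro exI[of _ "insert v3 (insert u M)"] exI[of _ F]) auto
  qed
  then obtain M3 F3 where 3: "M3 \<union> F3 = insert v3 (insert u W)" "M3 \<inter> F3 = {}" "F3 \<subseteq> insert v3 F"
    "bounded_on D m12 w M3" "acyclic_on m12 F3" by blast
  have f3: "finite F3" using 3(3) f(2) finite_subset by blast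
  have n3: "v1 \<notin> M3 \<union> F3" "v2 \<notin> M3 \<union> F3" unfolding 3(1) using nW vd ne by auto
  have sub3: "F3 - {x1, y1} \<subseteq> insert v3 (W - {x1, y1})" "insert v1 F3 - {x2, y2} \<subseteq> insert v1 (insert v3 (W - {x2, y2}))"
    using 3(3) sub(2) by auto
  have fW: "finite W" using fin[OF WV] .
  \<comment> \<open>\<open>u\<close> is in M and \<open>v3\<close> is not adjacent to
    \<open>v1\<close>, so \<open>v1\<close> has no neighbour in F3 besides \<open>x1\<close> and
    \<open>y1\<close>. The same reasons apply to \<open>v2\<close>.\<close>
  have z1: "degree m v1 (F3 - {x1, y1}) = 0"
    using degree_mono[OF _ sub3(1), of m v1] fW nW i 1(4)[of "W - {x1, y1}"] by (simp add: degree_insert)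
  have z2: "degree m v2 (insert v1 F3 - {x2, y2}) = 0"
    using degree_mono[OF _ sub3(2), of m v2] fW nW i vd 2(4)[of "W - {x2, y2}"] by (simp add: degree_insert)
  have "acyclic_on m2 (insert v1 F3)"
    by (rule acyclic_on_subdivide[OF m2m(1) f3 _ 1(1) 3(5)[unfolded m12_def]])
      (use n3 z1 dg2[OF nW(2)] m2v[OF nW(2)] P_simple[OF v(1)] 1(2,3) WV in auto)
  then have "acyclic_on m (insert v2 (insert v1 F3))"
    using n3 z2 vd f3 P_simple[OF v(2)] 2(2,3) WV by (intro acyclic_on_subdivide[OF m _ _ 2(1)]) (auto simp: m2_def)
  moreover have "bounded_on D m w M3"
    by (rule bounded_on_mono_fun[OF 3(4)]) (simp add: m12_def m2_def add_edge_def)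
  moreover have "insert v2 (insert v1 (M3 \<union> F3)) = V" unfolding 3(1) W using RV by auto
  then have "M3 \<union> insert v2 (insert v1 F3) = V" by auto
  moreover have "M3 \<inter> insert v2 (insert v1 F3) = {}" using 3(2) n3 by auto
  ultimately show False using finish by blast
qed

text \<open>Call \<^term>\<open>v\<close> bad if its two remaining neighbours lie, together with \<^term>\<open>c\<close>, in a set of small
  potential. By submodularity of the potential two of the three vertices cannot both be bad, so two of
  them satisfy the hypothesis of the preceding lemma.\<close>

lemma deg4_three_P:
  assumes u: "u \<in> V" "degree m u V = 4" "w u = 0"
    and v: "v1 \<in> P" "v2 \<in> P" "v3 \<in> P" and vd: "v1 \<noteq> v2" "v1 \<noteq> v3" "v2 \<noteq> v3"
    and e: "0 < m u v1" "0 < m u v2" "0 < m u v3"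
  shows False
proof -
  note V = P_D(1)[OF v(1)] P_D(1)[OF v(2)] P_D(1)[OF v(3)]
  have uP: "u \<notin> P" using u by (auto simp: P_def)
  then have ne: "u \<noteq> v1" "u \<noteq> v2" "u \<noteq> v3" using v by auto
  note es = P_sym_simple[OF v(1) u(1) e(1)] P_sym_simple[OF v(2) u(1) e(2)] P_sym_simple[OF v(3) u(1) e(3)]
  have RV: "{u, v1, v2, v3} \<subseteq> V" using u V by auto
  define W where "W = V - {u, v1, v2, v3}"
  have "degree m u W = 1"
    using degree_split[OF RV, of u] ne vd es u unfolding W_def[symmetric] by (simp_all add: degree_insert)
  then obtain c where c: "c \<in> W" "0 < m u c" using degree_pos[of m u W] by auto
  have WV: "W \<subseteq> V" and nW: "u \<notin> W" "v1 \<notin> W" "v2 \<notin> W" "v3 \<notin> W" by (auto simp: W_def)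
  define bad where "bad = (\<lambda>v. \<exists>T\<subseteq>W. c \<in> T \<and> degree m v T = 2 \<and> p m w T < 6 * int q + 7)"
  have dW: "degree m z W \<le> 2" if "z = v1 \<or> z = v2 \<or> z = v3" for z
  proof -
    have zP: "z \<in> P" "0 < m u z" using that v e by auto
    have "m z u + degree m z W \<le> degree m z V"
      using degree_insert[of W u m z] degree_W[of "insert u W" V z] fin[OF WV] nW u(1) WV by simp
    then show ?thesis using P_sym_simple[OF zP(1) u(1) zP(2)] P_D(2)[OF zP(1)] by simp
  qed
  have not_both: "\<not> (bad x \<and> bad y)"
    if xyz: "x \<in> {v1, v2, v3}" "y \<in> {v1, v2, v3}" "x \<noteq> y" for x y
  proof
    assume "bad x \<and> bad y"
    then obtain A B where A: "A \<subseteq> W" "c \<in> A" "degree m x A = 2" "p m w A < 6 * int q + 7"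
      and B: "B \<subseteq> W" "c \<in> B" "degree m y B = 2" "p m w B < 6 * int q + 7"
      unfolding bad_def by blast
    obtain z where z: "z \<in> {v1, v2, v3}" "z \<noteq> x" "z \<noteq> y" using xyz vd by blast
    have ABW: "A \<union> B \<subseteq> W" using A B by auto
    have f: "finite A" "finite B" using A B WV fin by auto
    have "2 \<le> degree m x (A \<union> B)" "2 \<le> degree m y (A \<union> B)"
      using degree_mono[of "A \<union> B" A m x] degree_mono[of "A \<union> B" B m y] f A(3) B(3) by simp_all
    moreover have "degree m x (A \<union> B) \<le> 2" "degree m y (A \<union> B) \<le> 2"
      using order_trans[OF degree_W[OF ABW WV] dW] xyz by auto
    ultimately have "degree m x (A \<union> B) = 2" "degree m y (A \<union> B) = 2" by linarith+
    moreover have xP: "x \<in> P" "y \<in> P" "0 < m u x" "0 < m u y" "z \<in> V" using xyz z v e V by auto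
    moreover have nx: "u \<notin> A \<union> B" "x \<notin> A \<union> B" "y \<notin> A \<union> B" "z \<notin> insert u (insert x (insert y (A \<union> B)))"
      using ABW nW xyz z ne by auto
    moreover have "A \<union> B \<subseteq> V" using ABW WV by auto
    \<comment> \<open>The union has potential at least \<open>12 * q + 11\<close> and the
      intersection, which contains \<open>c\<close>, at least \<open>4 * q + 3\<close>; two bad sets
      have at most \<open>12 * q + 12\<close> together.\<close>
    ultimately have "8 * int q + 7 + k * int (degree m u (A \<union> B)) \<le> p m w (A \<union> B)"
      using star_pair[OF u(1,3) uP, of x y "A \<union> B" z] xyz(3) by simp
    moreover have "1 \<le> degree m u (A \<union> B)" using degree_ge[of "A \<union> B" c m u] f A(2) c(2) by simp
    then have "k * int 1 \<le> k * int (degree m u (A \<union> B))" using k by (intro int_mult_mono) auto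
    then have "k \<le> k * int (degree m u (A \<union> B))" by (simp only: of_nat_1 mult_1_right)
    moreover have "k - 1 \<le> p m w (A \<inter> B)" using A B WV nW u(1) by (intro gap) auto
    moreover have "p m w (A \<union> B) + p m w (A \<inter> B) \<le> p m w A + p m w B"
      using pot_submodular[OF m f] k by simp
    ultimately show False using A(4) B(4) k by linarith
  qed
  have good: "6 * int q + 7 \<le> p m w T" if "\<not> bad v" "T \<subseteq> W" "c \<in> T" "degree m v T = 2" for v T
    using that unfolding bad_def by force
  consider "\<not> bad v1" "\<not> bad v2" | "\<not> bad v1" "\<not> bad v3" | "\<not> bad v2" "\<not> bad v3"
    using not_both[of v1 v2] not_both[of v1 v3] not_both[of v2 v3] vd by auto
  then show False
  proof cases
    case 1
    show False
      by (rule deg4_three_P_aux[OF u v vd e W_def c]) (use good 1 in auto)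
  next
    case 2
    have W2: "W = V - {u, v1, v3, v2}" by (auto simp: W_def)
    show False
      by (rule deg4_three_P_aux[OF u v(1,3,2) vd(2,1) vd(3)[symmetric] e(1,3,2) W2 c]) (use good 2 in auto)
  next
    case 3
    have W2: "W = V - {u, v2, v3, v1}" by (auto simp: W_def)
    show False
      by (rule deg4_three_P_aux[OF u v(2,3,1) vd(3) vd(1)[symmetric] vd(2)[symmetric] e(2,3,1) W2 c])
        (use good 3 in auto)
  qed
qed


section \<open>Discharging for odd D\<close>

lemma degree_P: assumes "x \<in> V" shows "degree m x P = card {v \<in> P. 0 < m x v}"
proof -
  have "m x v = (if 0 < m x v then 1 else 0)" if "v \<in> P" for v
    using P_simple[OF that assms] msym[of x v] by auto
  then have "degree m x P = (\<Sum>v\<in>P. if 0 < m x v then 1 else 0)" unfolding degree_def by (intro sum.cong) auto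
  also have "\<dots> = card {v \<in> P. 0 < m x v}" using fP by (simp add: sum.If_cases Int_def)
  finally show ?thesis .
qed

lemma many_P:
  assumes "x \<in> V" "n \<le> degree m x P"
  obtains N where "N \<subseteq> P" "card N = n" "\<And>v. v \<in> N \<Longrightarrow> 0 < m x v"
proof -
  obtain N where "N \<subseteq> {v \<in> P. 0 < m x v}" "card N = n"
    using assms(2) obtain_subset_with_card_n unfolding degree_P[OF assms(1)] by blast
  then show thesis by (intro that[of N]) auto
qed

text \<open>The share of \<open>x\<close> in the potential of V when each edge charges
  \<open>k / 2 = 2 * q + 2\<close> to either end.\<close>

definition "c x = a (w x) - (2 * int q + 2) * int (degree m x V)"

lemma pot_c: "p m w V = (\<Sum>x\<in>V. c x)"
proof -
  have "2 * p m w V = (\<Sum>x\<in>V. 2 * c x)"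
    unfolding pot_V by (rule sum.cong) (simp_all add: c_def k algebra_simps)
  then show ?thesis by (simp add: sum_distrib_left[symmetric])
qed

lemma c_P: "x \<in> P \<Longrightarrow> c x = 1"
  using P_D[of x] aq by (simp add: c_def)

text \<open>\<open>3 * c x + degree m x P\<close> is three times the charge of \<open>x\<close>
  after each neighbour in P has sent a third. The reducible configurations bring it to at most
  \<open>-1\<close> at degree four and weight 0, and to at most \<open>-2\<close> elsewhere, so the
  value \<open>-1\<close> pins the vertex down.\<close>

lemma c_bounds:
  assumes x: "x \<in> V - P"
  shows "c x \<le> - 1" "3 * c x + int (degree m x P) \<le> - 1"
    "w x \<noteq> 0 \<or> degree m x V \<noteq> 4 \<Longrightarrow> 3 * c x + int (degree m x P) \<le> - 2"
    "- 3 \<le> 3 * c x + int (degree m x P) \<Longrightarrow> degree m x P \<le> 2"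
proof -
  have xV: "x \<in> V" and xP: "x \<notin> P" using x by auto
  have PV: "P \<subseteq> V" by (auto simp: P_def)
  have eP: "degree m x P \<le> degree m x V" using degree_W[OF PV order_refl] .
  have mono: "int ((2 * q + 2) * n) \<le> int ((2 * q + 2) * degree m x V)" if "n \<le> degree m x V" for n
    using that unfolding of_nat_le_iff by (rule mult_le_mono2)
  have c: "c x = a (w x) - int ((2 * q + 2) * degree m x V)" by (simp add: c_def algebra_simps)
  have big: "a n = 4 * int q + 3" if "D < n" for n using a_big[OF that] k by simp
  have a2: "a n \<le> 8 * int q + 5" if "1 \<le> n" for n
    using that a[of n] big[of n] D by (cases "n \<le> D") auto
  have a3: "a n \<le> 6 * int q + 3" if "q + 2 \<le> n" for n
    using that a[of n] big[of n] D by (cases "n \<le> D") auto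
  note d2 = deg2[OF xV]
  consider "degree m x V \<ge> 5" | "degree m x V = 4" "w x \<noteq> 0" | "degree m x V = 4" "w x = 0"
    | "degree m x V = 3" "q + 2 \<le> w x" | "degree m x V = 3" "w x = q + 1"
    | "degree m x V = 3" "w x = q" | "degree m x V = 3" "w x < q" | "degree m x V = 2" "D < w x"
  proof -
    have "5 \<le> degree m x V \<or> degree m x V = 4 \<or> degree m x V = 3 \<or> degree m x V = 2" using d2 by linarith
    moreover have "q + 2 \<le> w x \<or> w x = q + 1 \<or> w x = q \<or> w x < q" by linarith
    moreover have "D < w x" if "degree m x V = 2" using deg3[OF xV] that by (cases "w x \<le> D") simp_all
    ultimately show thesis using that by blast
  qed
  then have "c x \<le> - 1 \<and> 3 * c x + int (degree m x P) \<le> - 1 \<and>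
      (w x \<noteq> 0 \<or> degree m x V \<noteq> 4 \<longrightarrow> 3 * c x + int (degree m x P) \<le> - 2) \<and>
      (- 3 \<le> 3 * c x + int (degree m x P) \<longrightarrow> degree m x P \<le> 2)"
  proof cases
    case 1
    then obtain n where n: "degree m x V = 5 + n" using le_Suc_ex by blast
    have "int ((2 * q + 2) * degree m x V) = 10 * int q + 10 + 2 * (int q * int n) + 2 * int n"
      unfolding n by (simp add: algebra_simps)
    moreover have "0 \<le> int q * int n" by simp
    moreover have "a (w x) \<le> 8 * int q + 7" using a_le[of "w x"] k by simp
    ultimately have "3 * c x + int (degree m x P) \<le> - 4" "c x \<le> - 1"
      using c eP n by linarith+
    then show ?thesis by linarith
  next
    case 2
    then have "c x \<le> - 3" using c a2[of "w x"] by simp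
    then show ?thesis using eP 2(1) by linarith
  next
    case 3
    have "degree m x P \<le> 2"
    proof (rule ccontr)
      assume "\<not> degree m x P \<le> 2"
      then obtain N where N: "N \<subseteq> P" "card N = 3" "\<And>v. v \<in> N \<Longrightarrow> 0 < m x v"
        using many_P[OF xV, of 3] by auto
      then obtain v1 v2 v3 where "N = {v1, v2, v3}" "v1 \<noteq> v2" "v1 \<noteq> v3" "v2 \<noteq> v3"
        by (auto simp: card_3_iff)
      then show False using deg4_three_P[OF xV 3, of v1 v2 v3] N by auto
    qed
    moreover have "c x = - 1" using c 3 a0 by simp
    ultimately show ?thesis using 3 by simp
  next
    case 4
    then have "c x \<le> - 3" using c a3[of "w x"] by simp
    then show ?thesis using eP 4(1) by linarith
  next
    case 5
    have "degree m x P \<le> 1"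
    proof (rule ccontr)
      assume "\<not> degree m x P \<le> 1"
      then obtain N where N: "N \<subseteq> P" "card N = 2" "\<And>v. v \<in> N \<Longrightarrow> 0 < m x v"
        using many_P[OF xV, of 2] by auto
      then obtain v1 v2 where "N = {v1, v2}" "v1 \<noteq> v2" by (auto simp: card_2_iff)
      then show False using deg3_one_P[OF xV 5, of v1 v2] N by auto
    qed
    moreover have "c x = - 1" using c 5 aq1 by simp
    ultimately show ?thesis by linarith
  next
    case 6
    then show ?thesis using xP xV by (simp add: P_def)
  next
    case 7
    then have "w x \<le> D" using D by simp
    then have False using light_deg3[OF xV 7(1)] a[of "w x"] k 7(2) D by simp
    then show ?thesis ..
  next
    case 8
    have "degree m x P = 0" unfolding degree_def using deg2_no_P[OF xV 8] by (intro sum.neutral) auto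
    moreover have "c x = - 1" using c 8 big[of "w x"] by simp
    ultimately show ?thesis by linarith
  qed
  then show "c x \<le> - 1" "3 * c x + int (degree m x P) \<le> - 1"
    "w x \<noteq> 0 \<or> degree m x V \<noteq> 4 \<Longrightarrow> 3 * c x + int (degree m x P) \<le> - 2"
    "- 3 \<le> 3 * c x + int (degree m x P) \<Longrightarrow> degree m x P \<le> 2"
    by blast+
qed

text \<open>Each vertex of P passes a third of its surplus along each of its edges. The bounds above leave
  only \<open>K\<^sub>5\<close> minus an edge, which is colourable.\<close>

lemma odd_False: False
proof -
  define Q where "Q = V - P"
  have PV: "P \<subseteq> V" by (auto simp: P_def)
  have fQ: "finite Q" and VPQ: "P \<union> Q = V" "P \<inter> Q = {}" using PV fV by (auto simp: Q_def)
  note cb = c_bounds[folded Q_def]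
  have dgPP: "degree m v P = 0" if "v \<in> P" for v
    unfolding degree_def using P_indep[OF that] by (intro sum.neutral) auto
  have "degree m v Q = 3" if "v \<in> P" for v
    using degree_Un[OF fP fQ VPQ(2), of m v] dgPP[OF that] P_D(2)[OF that] VPQ(1) by simp
  then have "(\<Sum>v\<in>P. degree m v Q) = 3 * card P" by simp
  then have e3: "(\<Sum>x\<in>Q. degree m x P) = 3 * card P" using degree_sum_swap[OF m, of P Q] by simp
  have "(\<Sum>x\<in>V. c x) = (\<Sum>x\<in>P. c x) + (\<Sum>x\<in>Q. c x)"
    using sum.union_disjoint[OF fP fQ VPQ(2), of c] unfolding VPQ(1) .
  then have "(\<Sum>x\<in>V. c x) = int (card P) + (\<Sum>x\<in>Q. c x)" using c_P by simp
  moreover have "- 1 \<le> (\<Sum>x\<in>V. c x)" using potV[of V] V_ne pot_c by simp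
  ultimately have sc: "- 1 - int (card P) \<le> (\<Sum>x\<in>Q. c x)" by simp
  have "(\<Sum>x\<in>Q. 3 * c x + int (degree m x P)) = 3 * (\<Sum>x\<in>Q. c x) + int (\<Sum>x\<in>Q. degree m x P)"
    by (simp add: sum.distrib sum_distrib_left)
  \<comment> \<open>P gives away all it has: each of its vertices starts with charge 1 and has three
    edges, all to Q.\<close>
  then have s3: "- 3 \<le> (\<Sum>x\<in>Q. 3 * c x + int (degree m x P))" using sc e3 by simp
  have "(\<Sum>x\<in>Q. 3 * c x + int (degree m x P)) \<le> (\<Sum>x\<in>Q. - 1)" using cb(2) by (intro sum_mono) 
  then have Q3: "card Q \<le> 3" using s3 by simp
  have "(\<Sum>x\<in>Q. c x) \<le> (\<Sum>x\<in>Q. - 1)" using cb(1) by (intro sum_mono)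
  then have QP: "card Q \<le> card P + 1" using sc by simp
  have rest: "3 * c x + int (degree m x P) + (\<Sum>y\<in>Q - {x}. 3 * c y + int (degree m y P)) =
      (\<Sum>x\<in>Q. 3 * c x + int (degree m x P))" if "x \<in> Q" for x
    using sum.remove[OF fQ that, of "\<lambda>x. 3 * c x + int (degree m x P)"] by simp
  have rest_le: "(\<Sum>y\<in>Q - {x}. 3 * c y + int (degree m y P)) \<le> (\<Sum>y\<in>Q - {x}. - 1)" for x
    using cb(2) by (intro sum_mono) auto
  have e2: "degree m x P \<le> 2" if "x \<in> Q" for x
  proof (rule cb(4)[OF that])
    have "(\<Sum>y\<in>Q - {x}. 3 * c y + int (degree m y P)) \<le> 0"
      by (rule order_trans[OF rest_le]) simp
    then show "- 3 \<le> 3 * c x + int (degree m x P)" using rest[OF that] s3 by linarith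
  qed
  have eP: "degree m x P \<le> card P" if "x \<in> Q" for x
    using degree_P[of x] that card_mono[OF fP, of "{v \<in> P. 0 < m x v}"] by (auto simp: Q_def)
  have bnd: "3 * card P \<le> card Q * t" if "\<And>x. x \<in> Q \<Longrightarrow> degree m x P \<le> t" for t
    using sum_bounded_above[of Q "\<lambda>x. degree m x P" t] that e3 by simp
  have "card P \<noteq> 0"
  proof
    assume P0: "card P = 0"
    then have "P = {}" using fP by simp
    then have "V = Q" using VPQ(1) by blast
    moreover have "card V \<noteq> 0" using V_ne fV by simp
    ultimately have "card V = 1" using QP P0 by simp
    then show False using deg2 m by (auto simp: card_1_singleton_iff degree_insert)
  qed
  moreover have "card P \<noteq> 1"
  proof
    assume P1: "card P = 1"
    then have "3 * card P \<le> card Q * 1" using eP by (intro bnd) simp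
    then show False using P1 QP by linarith
  qed
  moreover have "card P \<le> 2" using bnd[of 2, OF e2] Q3 by linarith
  ultimately have P2: "card P = 2" by linarith
  then have Q3': "card Q = 3" using bnd[of 2, OF e2] Q3 by linarith
  have eq2: "degree m x P = 2" if x: "x \<in> Q" for x
  proof (rule ccontr)
    assume "degree m x P \<noteq> 2"
    then have "degree m x P \<le> 1" using e2[OF x] by simp
    moreover have "(\<Sum>y\<in>Q - {x}. degree m y P) \<le> card (Q - {x}) * 2"
      using sum_bounded_above[of "Q - {x}" "\<lambda>y. degree m y P" 2] e2 by simp
    moreover have "card (Q - {x}) = 2" using x fQ Q3' by simp
    ultimately show False using e3 P2 sum.remove[OF fQ x, of "\<lambda>y. degree m y P"] by simp
  qed
  \<comment> \<open>The three vertices of Q have total at least \<open>-3\<close>, so each of them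
    attains \<open>-1\<close>.\<close>
  have A: "w x = 0" "degree m x V = 4" if x: "x \<in> Q" for x
  proof -
    have "(\<Sum>y\<in>Q - {x}. - 1) = (- 2 :: int)" using x fQ Q3' by simp
    then have "\<not> 3 * c x + int (degree m x P) \<le> - 2" using rest[OF x] rest_le[of x] s3 by linarith
    then show "w x = 0" "degree m x V = 4" using cb(3)[OF x] by blast+
  qed
  obtain p1 p2 where pp: "P = {p1, p2}" "p1 \<noteq> p2" using P2 by (auto simp: card_2_iff)
  obtain x y z where xyz: "Q = {x, y, z}" "x \<noteq> y" "x \<noteq> z" "y \<noteq> z" using Q3' by (auto simp: card_3_iff)
  have mP: "m t p1 = 1" "m t p2 = 1" if "t \<in> Q" for t
    using eq2[OF that] P_simple[of p1 t] P_simple[of p2 t] msym[of t] pp that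
    by (auto simp: degree_insert Q_def)
  have dQ: "degree m t Q = 2" if "t \<in> Q" for t
    using degree_Un[OF fP fQ VPQ(2), of m t] A(2)[OF that] eq2[OF that] VPQ(1) by simp
  have "m x y + m x z = 2" "m x y + m y z = 2" "m x z + m y z = 2"
    using dQ[of x] dQ[of y] dQ[of z] xyz msym[of y x] msym[of z x] msym[of z y] by (simp_all add: degree_insert)
  then have mxy: "m x y = 1" by linarith
  have w0: "w x = 0" "w y = 0" using A xyz by auto
  have np: "p1 \<notin> Q" "p2 \<notin> Q" using pp VPQ(2) by auto
  \<comment> \<open>Q is a triangle joined to both vertices of P. The edge \<open>x y\<close> goes
    to M, the path \<open>p1 z p2\<close> to F.\<close>
  have "bounded_on D m w (insert x {y})"
  proof (rule bounded_on_insert[OF m _ _ bounded_on_sing[OF m, of "\<lambda>_. D" y]])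
    show "degree m x {y} \<le> 1" using mxy by (simp add: degree_insert)
  qed (use w0 xyz D in \<open>auto simp: degree_insert\<close>)
  moreover have "acyclic_on m {z}" using acyclic_on_insert[OF m, of "{}" z] by simp
  then have "acyclic_on m (insert p1 {z})"
    using np xyz mP(1)[of z] msym[of z p1] by (intro acyclic_on_insert[OF m]) (auto simp: degree_insert)
  then have "acyclic_on m (insert p2 (insert p1 {z}))"
  proof (rule acyclic_on_insert[OF m, rotated 2])
    show "degree m p2 (insert p1 {z}) \<le> 1"
      using np xyz mP(2)[of z] msym[of z p2] pp P_indep[of p2 p1] by (simp add: degree_insert)
  qed (use np xyz pp in auto)
  moreover have "insert x {y} \<union> insert p2 (insert p1 {z}) = V" using VPQ(1) pp xyz by auto
  moreover have "insert x {y} \<inter> insert p2 (insert p1 {z}) = {}" using np xyz by auto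
  ultimately show False using finish by blast
qed

end

section \<open>From minimal counterexamples to critical weighted graphs\<close>

context weights
begin

lemma no_counterexample_wcolorable:
  assumes none: "\<And>(V::'a set) m w. min_counterexample D k a V m w \<Longrightarrow> False"
    and "finite (V :: 'a set)" "mult_fun m" "\<And>S. S \<subseteq> V \<Longrightarrow> S \<noteq> {} \<Longrightarrow> - 1 \<le> p m w S"
  shows "wcolorable D m w V"
  using assms(2-)
proof (induction "card V" arbitrary: V m w rule: less_induct)
  case less
  show ?case
  proof (rule ccontr)
    assume "\<not> wcolorable D m w V"
    then have "min_counterexample D k a V m w"
      using less by unfold_locales blast+
    then show False by (rule none)
  qed
qed

text \<open>Unlike the previous lemma, criticality puts no lower bound on the potential of proper subsets.
  It makes them colourable instead, so a proper subset of least potential can be contracted.\<close>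

lemma critical_pot:
  fixes V :: "'a set"
  assumes none: "\<And>(V::'a set) m w. min_counterexample D k a V m w \<Longrightarrow> False"
    and fV: "finite V" and m: "mult_fun m" and nc: "\<not> wcolorable D m w V"
    and sub: "\<And>S. S \<subset> V \<Longrightarrow> wcolorable D m w S"
  shows "p m w V \<le> - 2"
proof (rule ccontr)
  assume pV: "\<not> p m w V \<le> - 2"
  have "\<exists>S\<subseteq>V. S \<noteq> {} \<and> \<not> - 1 \<le> p m w S"
  proof (rule ccontr)
    assume n: "\<not> (\<exists>S\<subseteq>V. S \<noteq> {} \<and> \<not> - 1 \<le> p m w S)"
    have "wcolorable D m w V"
    proof (rule no_counterexample_wcolorable[OF none fV m])
      show "- 1 \<le> p m w S" if "S \<subseteq> V" "S \<noteq> {}" for S using n that by blast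
    qed
    then show False using nc by simp
  qed
  then obtain S where S: "S \<subseteq> V" "S \<noteq> {}" "\<not> - 1 \<le> p m w S" by blast
  then have SV: "S \<subset> V" using pV by auto
  define \<F> where "\<F> = {B. B \<subset> V \<and> B \<noteq> {}}"
  have F: "finite \<F>" "S \<in> \<F>"
    using fV SV S by (auto simp: \<F>_def intro: finite_subset[of _ "Pow V"])
  define A where "A = arg_min_on (p m w) \<F>"
  have A: "A \<in> \<F>" and min: "\<And>B. B \<in> \<F> \<Longrightarrow> p m w A \<le> p m w B"
    using arg_min_if_finite[of \<F> "p m w"] F unfolding A_def by (auto simp: not_less)
  have AV: "A \<subset> V" "A \<noteq> {}" using A by (auto simp: \<F>_def)
  have r2: "p m w A \<le> - 2" using min[OF F(2)] S(3) by linarith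
  have fA: "finite A" using AV(1) fV by (auto intro: finite_subset)
  have d1: "degree m x A \<le> 1" if x: "x \<in> V - A" for x
  proof (rule ccontr)
    assume "\<not> degree m x A \<le> 1"
    then have "k * int 2 \<le> k * int (degree m x A)" using k3 by (intro int_mult_mono) auto
    then have "k * 2 \<le> k * int (degree m x A)" by simp
    moreover have "p m w (insert x A) = p m w A + a (w x) - k * int (degree m x A)"
      using x by (intro pot_insert[OF m fA]) auto
    moreover have "p m w A \<le> p m w (insert x A)"
    proof (cases "insert x A = V")
      case True
      then show ?thesis using pV r2 by simp
    next
      case False
      then show ?thesis using x AV by (intro min) (auto simp: \<F>_def)
    qed
    ultimately show False using a_le[of "w x"] by linarith
  qed
  show False
  proof (cases "\<exists>x\<in>V - A. \<exists>s\<in>A. 0 < m x s")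
    case False
    have "V - A \<subset> V" using AV by auto
    have "m x s = 0" if "x \<in> V - A" "s \<in> A" for x s using False that by auto
    then have "wcolorable D m w V"
      using wcolorable_disjoint[OF m fV psubset_imp_subset[OF AV(1)] sub[OF AV(1)] sub[OF \<open>V - A \<subset> V\<close>]] by simp
    then show False using nc by simp
  next
    case True
    then obtain x0 s0 where x0: "x0 \<in> V - A" and s0: "s0 \<in> A" and e0: "0 < m x0 s0" by blast
    \<comment> \<open>The potential of A is negative, so nothing has to be saved at
      \<open>x0\<close> and \<open>s0\<close> is raised by 0.\<close>
    obtain MS FS where MF: "MS \<union> FS = A" "MS \<inter> FS = {}" "bounded_on D m (w(s0 := w s0 + 0)) MS" "acyclic_on m FS"
      using sub[OF AV(1)] unfolding wcolorable_def by auto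
    have "wcolorable D m w V"
    proof (rule contract_step[OF m fV _ _ _ _ d1 x0 s0 e0 MF])
      show "p m w A \<le> p m w B" if "A \<subset> B" "B \<subset> V" for B
        using that by (intro min) (auto simp: \<F>_def)
      show "wcolorable D m' w' (insert s0 (V - A))"
        if "mult_fun m'" "\<And>T. T \<subseteq> insert s0 (V - A) \<Longrightarrow> T \<noteq> {} \<Longrightarrow> - 1 \<le> p m' w' T" for m' w'
        using that fV by (intro no_counterexample_wcolorable[OF none]) auto
    qed (use AV pV r2 k3 in auto)
    then show False using nc by simp
  qed
qed

end

text \<open>The step from weight \<open>g\<close> to \<open>g + 1\<close> costs 1, all others cost 2. Its position matters:
  \<open>K\<^sub>4\<close> with all weights \<open>g\<close> is not colourable and has potential exactly \<open>- 2\<close>.\<close>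

definition pot_even :: "nat \<Rightarrow> nat \<Rightarrow> int" where
  "pot_even g n = (if n \<le> g then 8 * int g + 1 - 2 * int n
     else if n \<le> 2 * g then 8 * int g + 2 - 2 * int n else 4 * int g)"

definition pot_odd :: "nat \<Rightarrow> nat \<Rightarrow> int" where
  "pot_odd q n = (if n \<le> 2 * q + 1 then 8 * int q + 7 - 2 * int n else 4 * int q + 3)"

text \<open>With \<open>j\<close> the integer part of \<open>(r + 1) / 2\<close> the raises cost at
  most \<open>2 * j <= r + 1\<close> and \<open>k - 2 * j <= k - r\<close>.\<close>

lemma weights_odd: "weights (2 * q + 1) (4 * int q + 4) (pot_odd q)"
proof
  fix n i :: nat
  show step: "pot_odd q n \<le> pot_odd q (n + i) + 2 * int i" for n i
    by (auto simp: pot_odd_def)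
  fix r :: int and u x :: nat
  assume r: "- 1 \<le> r" "r < 4 * int q + 4"
  define j where "j = nat ((r + 1) div 2)"
  have j: "2 * int j \<le> r + 1" "r \<le> 2 * int j" "j \<le> 2 * q + 2" using r by (auto simp: j_def)
  have "pot_odd q u - pot_odd q (u + j) \<le> r + 1" using step[of u j] j by linarith
  moreover have "pot_odd q x - pot_odd q (x + (2 * q + 1 + 1 - j)) \<le> 4 * int q + 4 - r"
    using step[of x "2 * q + 1 + 1 - j"] j by (simp add: of_nat_diff)
  ultimately show "\<exists>j. pot_odd q u - pot_odd q (u + j) \<le> r + 1 \<and>
      (2 * q + 1 < u + j \<or> pot_odd q x - pot_odd q (x + (2 * q + 1 + 1 - j)) \<le> 4 * int q + 4 - r)"
    by blast
qed (auto simp: pot_odd_def)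

text \<open>For odd \<open>r\<close> the raise \<open>(r + 1) / 2\<close> and its complement fit
  exactly. For even \<open>r\<close> one unit is missing, to be saved at the cheap step. If
  \<open>u\<close> crosses it with \<open>r / 2 + 1\<close>, that raise is taken. Otherwise let
  \<open>j = r / 2\<close>. If \<open>j <= g\<close>, then \<open>x\<close> crosses it, or starts
  above \<open>g\<close> and can lose only \<open>2 * g\<close>; if \<open>j > g\<close>, then
  \<open>u\<close> starts above \<open>g\<close> and \<open>u + j\<close> exceeds
  \<open>D\<close>.\<close>

lemma weights_even:
  assumes g: "1 \<le> g"
  shows "weights (2 * g) (4 * int g + 1) (pot_even g)"
proof
  fix n i :: nat
  show step: "pot_even g n \<le> pot_even g (n + i) + 2 * int i" for n i
    by (auto simp: pot_even_def)
  have cross: "pot_even g n \<le> pot_even g (n + i) + 2 * int i - 1" if "n \<le> g" "g < n + i" for n i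
    using that by (auto simp: pot_even_def)
  fix r :: int and u x :: nat
  assume r: "- 1 \<le> r" "r < 4 * int g + 1"
  let ?P = "\<lambda>j. pot_even g u - pot_even g (u + j) \<le> r + 1 \<and>
      (2 * g < u + j \<or> pot_even g x - pot_even g (x + (2 * g + 1 - j)) \<le> 4 * int g + 1 - r)"
  show "\<exists>j. ?P j"
  proof (cases "odd r")
    case True
    then obtain b where b: "r = 2 * b + 1" by (rule oddE)
    define j where "j = nat (b + 1)"
    have j: "2 * int j = r + 1" using r b by (simp add: j_def)
    then have "?P j" using step[of u j] step[of x "2 * g + 1 - j"] r by (simp add: of_nat_diff)
    then show ?thesis ..
  next
    case False
    then obtain b where b: "r = 2 * b" by auto
    define j where "j = nat b"
    have j: "2 * int j = r" "j \<le> 2 * g" using r b by (auto simp: j_def)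
    show ?thesis
    proof (cases "u \<le> g \<and> g < u + (j + 1)")
      case True
      then have "?P (j + 1)"
        using cross[of u "j + 1"] step[of x "2 * g + 1 - (j + 1)"] j by (simp add: of_nat_diff)
      then show ?thesis ..
    next
      case u: False
      have "?P j"
      proof (cases "j \<le> g")
        case True
        have "pot_even g x - pot_even g (x + (2 * g + 1 - j)) \<le> 4 * int g + 1 - r"
        proof (cases "x \<le> g")
          case True
          have "int (2 * g + 1 - j) = 2 * int g + 1 - int j" "g < x + (2 * g + 1 - j)"
            using \<open>j \<le> g\<close> by linarith+
          then show ?thesis using cross[of x "2 * g + 1 - j"] True j by linarith
        next
          case False
          then show ?thesis using \<open>j \<le> g\<close> j by (auto simp: pot_even_def)
        qed
        then show ?thesis using step[of u j] j by auto
      next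
        case False
        then show ?thesis using step[of u j] j u by auto
      qed
      then show ?thesis ..
    qed
  qed
qed (use g in \<open>auto simp: pot_even_def\<close>)

lemma critical_even:
  fixes V :: "'a set"
  assumes g: "1 \<le> g" and fV: "finite V" and m: "mult_fun m" and "\<not> wcolorable (2 * g) m w V"
    and "\<And>S. S \<subset> V \<Longrightarrow> wcolorable (2 * g) m w S"
  shows "pot (pot_even g) (4 * int g + 1) m w V \<le> - 2"
proof (rule weights.critical_pot[OF weights_even[OF g] _ fV m assms(4,5)])
  fix V :: "'a set" and m w
  assume "min_counterexample (2 * g) (4 * int g + 1) (pot_even g) V m w"
  then show False
    by (rule min_counterexample.even_False[OF _ refl g refl]) (auto simp: pot_even_def)
qed

lemma critical_odd:
  fixes V :: "'a set"
  assumes fV: "finite V" and m: "mult_fun m" and "\<not> wcolorable (2 * q + 1) m w V"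
    and "\<And>S. S \<subset> V \<Longrightarrow> wcolorable (2 * q + 1) m w S"
  shows "pot (pot_odd q) (4 * int q + 4) m w V \<le> - 2"
proof (rule weights.critical_pot[OF weights_odd _ fV m assms(3,4)])
  fix V :: "'a set" and m w
  assume "min_counterexample (2 * q + 1) (4 * int q + 4) (pot_odd q) V m w"
  then have "odd_counterexample (2 * q + 1) (4 * int q + 4) (pot_odd q) V m w q"
    by (intro odd_counterexample.intro) (auto simp: odd_counterexample_axioms_def pot_odd_def)
  then show False by (rule odd_counterexample.odd_False)
qed

section \<open>Critical multigraphs\<close>

text \<open>The diagonal is set to 0 because \<open>{x, x}\<close> is a singleton, which an
  arbitrary multiset of sets may contain.\<close>

definition edge_mult :: "'a set multiset \<Rightarrow> 'a \<Rightarrow> 'a \<Rightarrow> nat" where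
  "edge_mult E x y = (if x = y then 0 else count E {x, y})"

lemma mult_fun_edge_mult: "mult_fun (edge_mult E)"
  by (auto simp: mult_fun_def edge_mult_def insert_commute)

lemma edge_mult_pos: "0 < edge_mult E x y \<longleftrightarrow> x \<noteq> y \<and> {x, y} \<in># E"
  by (auto simp: edge_mult_def)

lemma edge_count_edge_mult:
  assumes "\<forall>e\<in>#E. card e = 2" "finite A"
  shows "edge_count (edge_mult E) A = size {#e \<in># E. e \<subseteq> A#}"
  using assms(1)
proof (induction E)
  case empty
  have "degree (edge_mult {#}) x A = 0" for x :: 'a
    unfolding degree_def by (intro sum.neutral ballI) (simp add: edge_mult_def)
  then show ?case by (simp add: edge_count_def)
next
  case (add e E)
  then obtain x y where xy: "e = {x, y}" "x \<noteq> y" by (auto simp: card_2_iff)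
  have "edge_mult (add_mset e E) = add_edge x y (edge_mult E)"
    using xy by (auto simp: edge_mult_def add_edge_def fun_eq_iff doubleton_eq_iff)
  then show ?case
    using add edge_count_add_edge[OF mult_fun_edge_mult assms(2) xy(2), of E] xy by simp
qed

lemma filter_filter_subset:
  "A \<subseteq> B \<Longrightarrow> {#e \<in># {#e \<in># E. e \<subseteq> B#}. e \<subseteq> A#} = {#e \<in># E. e \<subseteq> A#}"
  unfolding filter_filter_mset by (rule filter_mset_cong) auto

lemma multigraph_finite: "multigraph G \<Longrightarrow> A \<subseteq> verts G \<Longrightarrow> finite A"
  unfolding multigraph_def using finite_subset by blast

lemma multigraph_induced: "multigraph G \<Longrightarrow> multigraph (induced G S)"
  by (auto simp: multigraph_def induced_def)

section \<open>Cycles, forests and components in terms of edge counts\<close>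

lemma cycle_edge_subset:
  assumes "e \<in> set (map (\<lambda>i. {vs ! i, vs ! (Suc i mod length vs)}) [0..<length vs])"
  shows "e \<subseteq> set vs"
proof -
  obtain i where i: "i < length vs" "e = {vs ! i, vs ! (Suc i mod length vs)}" using assms by auto
  then have "Suc i mod length vs < length vs" by (intro mod_less_divisor) auto
  then show ?thesis using i by auto
qed

text \<open>A cycle has as many edges, counted with multiplicity, as vertices, and all lie inside
  its vertex set; this covers a doubled edge too.\<close>

lemma is_cycle_edge_count:
  assumes G: "multigraph G" and c: "is_cycle G vs"
  shows "set vs \<subseteq> verts G" "set vs \<noteq> {}" "card (set vs) \<le> edge_count (edge_mult (edges G)) (set vs)"
proof -
  let ?L = "map (\<lambda>i. {vs ! i, vs ! (Suc i mod length vs)}) [0..<length vs]"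
  have v: "2 \<le> length vs" "distinct vs" "set vs \<subseteq> verts G" "mset ?L \<subseteq># edges G"
    using c by (auto simp: is_cycle_def)
  have "mset ?L = {#e \<in># mset ?L. e \<subseteq> set vs#}"
    using cycle_edge_subset by (intro filter_mset_eq_conv[THEN iffD2, symmetric]) (auto simp del: mset_map set_map)
  also have "\<dots> \<subseteq># {#e \<in># edges G. e \<subseteq> set vs#}" using v(4) by (rule multiset_filter_mono)
  finally have "size (mset ?L) \<le> size {#e \<in># edges G. e \<subseteq> set vs#}" by (rule size_mset_mono)
  then show "card (set vs) \<le> edge_count (edge_mult (edges G)) (set vs)"
    using G v(2) by (subst edge_count_edge_mult) (auto simp: multigraph_def distinct_card)
  show "set vs \<subseteq> verts G" "set vs \<noteq> {}" using v by auto
qed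

lemma induced_edge_count:
  assumes "multigraph G" "A \<subseteq> S" "finite A"
  shows "edge_count (edge_mult (edges (induced G S))) A = edge_count (edge_mult (edges G)) A"
proof -
  have "\<forall>e\<in>#edges G. card e = 2" "\<forall>e\<in>#edges (induced G S). card e = 2"
    using assms(1) by (auto simp: multigraph_def induced_def)
  then show ?thesis
    using assms by (simp add: edge_count_edge_mult induced_def filter_filter_subset)
qed

lemma acyclic_on_forest:
  assumes G: "multigraph G" and F: "F \<subseteq> verts G" and g: "acyclic_on (edge_mult (edges G)) F"
  shows "forest (induced G F)"
proof -
  have False if "is_cycle (induced G F) vs" for vs
  proof -
    note c = is_cycle_edge_count[OF multigraph_induced[OF G] that]
    have "set vs \<subseteq> F" using c(1) by (auto simp: induced_def)
    then have "edge_count (edge_mult (edges G)) (set vs) < card (set vs)" using acyclic_on_D[OF g] c(2) by blast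
    then show False using c(3) induced_edge_count[OF G \<open>set vs \<subseteq> F\<close>] by simp
  qed
  then show ?thesis using multigraph_induced[OF G] by (auto simp: forest_def)
qed

abbreviation reach :: "'a mgraph \<Rightarrow> 'a \<Rightarrow> 'a set" where
  "reach G v \<equiv> {u. (v, u) \<in> (adjacency G)\<^sup>*}"

lemma reach_verts:
  assumes "multigraph G" "v \<in> verts G"
  shows "reach G v \<subseteq> verts G"
proof
  fix u assume "u \<in> reach G v"
  then have "(v, u) \<in> (adjacency G)\<^sup>*" by simp
  then show "u \<in> verts G"
    using assms by induction (auto simp: adjacency_def multigraph_def)
qed

lemma multigraph_adj:
  "multigraph G \<Longrightarrow> (x, y) \<in> adjacency G \<longleftrightarrow> 0 < edge_mult (edges G) x y"
  by (auto simp: adjacency_def edge_mult_pos multigraph_def)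

text \<open>Grow a set from \<open>v\<close>: while it is not the whole component an edge leaves it,
  and adding the outer end of that edge adds at least one edge.\<close>

lemma reach_edge_count:
  assumes G: "multigraph G" and v: "v \<in> verts G"
  shows "card (reach G v) \<le> Suc (edge_count (edge_mult (edges G)) (reach G v))"
proof -
  let ?R = "reach G v" and ?m = "edge_mult (edges G)"
  have fR: "finite ?R" using multigraph_finite[OF G reach_verts[OF G v]] .
  have "\<exists>B\<subseteq>?R. v \<in> B \<and> card B = Suc n \<and> Suc n \<le> Suc (edge_count ?m B)" if "Suc n \<le> card ?R" for n
    using that
  proof (induction n)
    case 0
    then show ?case by (intro exI[of _ "{v}"]) auto
  next
    case (Suc n)
    then obtain B where B: "B \<subseteq> ?R" "v \<in> B" "card B = Suc n" "Suc n \<le> Suc (edge_count ?m B)" by auto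
    have "\<exists>x\<in>B. \<exists>y. y \<notin> B \<and> (x, y) \<in> adjacency G"
    proof (rule ccontr)
      assume n: "\<not> (\<exists>x\<in>B. \<exists>y. y \<notin> B \<and> (x, y) \<in> adjacency G)"
      have "u \<in> B" if "(v, u) \<in> (adjacency G)\<^sup>*" for u
        using that by induction (use n B(2) in auto)
      then have "B = ?R" using B(1) by auto
      then show False using B(3) Suc.prems by simp
    qed
    then obtain x y where xy: "x \<in> B" "y \<notin> B" "(x, y) \<in> adjacency G" by blast
    have fB: "finite B" using B(1) fR finite_subset by blast
    have "0 < ?m y x" using xy multigraph_adj[OF G] mult_fun_edge_mult[of "edges G"] by (auto simp: mult_fun_def)
    then have "1 \<le> degree ?m y B" using degree_ge[OF fB xy(1), of ?m y] by simp
    moreover have "y \<in> ?R" using B(1) xy by (auto intro: rtrancl_into_rtrancl)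
    ultimately show ?case
      using B xy fB edge_count_insert[OF mult_fun_edge_mult fB xy(2), of "edges G"]
      by (intro exI[of _ "insert y B"]) auto
  qed
  note ex = this
  have "v \<in> ?R" by simp
  then have "card ?R \<noteq> 0" using fR by auto
  then obtain n where n: "card ?R = Suc n" by (cases "card ?R") auto
  then obtain B where "B \<subseteq> ?R" "card B = Suc n" "Suc n \<le> Suc (edge_count ?m B)" using ex[of n] by auto
  then show ?thesis using n card_subset_eq[OF fR, of B] by simp
qed

text \<open>A component is connected, so it has at least one edge less than vertices, and in an
  acyclic graph exactly one less. It is therefore among the sets whose size
  \<open>bounded_on\<close> restricts.\<close>

lemma wcolorable_DF_colorable:
  assumes G: "multigraph G" and c: "wcolorable D (edge_mult (edges G)) (\<lambda>_. 0) (verts G)"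
  shows "DF_colorable D G"
proof -
  obtain M F where MF: "M \<union> F = verts G" "M \<inter> F = {}" "bounded_on D (edge_mult (edges G)) (\<lambda>_. 0) M" "acyclic_on (edge_mult (edges G)) F"
    using c unfolding wcolorable_def by blast
  have sub: "M \<subseteq> verts G" "F \<subseteq> verts G" using MF by auto
  have FM: "acyclic_on (edge_mult (edges G)) M" using MF(3) by (auto simp: bounded_on_def acyclic_on_def)
  have "size (edges C) \<le> D" if C: "C \<in> components (induced G M)" for C
  proof -
    let ?H = "induced G M"
    have H: "multigraph ?H" by (rule multigraph_induced[OF G])
    obtain v where v: "v \<in> verts ?H" "C = induced ?H (reach ?H v)"
      using C by (auto simp: components_def)
    let ?R = "reach ?H v"
    have R: "?R \<subseteq> M" using reach_verts[OF H v(1)] by (auto simp: induced_def)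
    have fR: "finite ?R" using R sub(1) by (intro multigraph_finite[OF G]) auto
    have ne: "?R \<noteq> {}" by auto
    have e: "edge_count (edge_mult (edges ?H)) ?R = edge_count (edge_mult (edges G)) ?R" by (rule induced_edge_count[OF G R fR])
    have "size (edges C) = edge_count (edge_mult (edges ?H)) ?R"
      using H fR by (subst edge_count_edge_mult) (auto simp: v(2) induced_def[of ?H] multigraph_def)
    moreover have "Suc (edge_count (edge_mult (edges G)) ?R) = card ?R"
      using bounded_on_D(1)[OF MF(3) R ne] reach_edge_count[OF H v(1)] e by simp
    ultimately show ?thesis using bounded_on_D(2)[OF MF(3) R ne] e by simp
  qed
  then have "DF_coloring D G M F"
    using MF(1,2) acyclic_on_forest[OF G sub(1) FM] acyclic_on_forest[OF G sub(2) MF(4)] by (simp add: DF_coloring_def)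
  then show ?thesis by (auto simp: DF_colorable_def)
qed

lemma distinct_mset_subset:
  "distinct l \<Longrightarrow> set l \<subseteq> set_mset E \<Longrightarrow> mset l \<subseteq># E"
  by (rule mset_subset_eqI) (simp add: distinct_count_atmost_1 count_greater_zero_iff Suc_le_eq subset_iff)

text \<open>A longest path in a subgraph of minimum degree two closes up to a cycle at its end.\<close>

lemma min_degree_cycle:
  assumes fB: "finite B" and ne: "B \<noteq> {}" and deg: "\<And>x. x \<in> B \<Longrightarrow> 2 \<le> degree (edge_mult E) x B"
  shows "\<exists>vs. 2 \<le> length vs \<and> distinct vs \<and> set vs \<subseteq> B \<and>
     mset (map (\<lambda>i. {vs ! i, vs ! (Suc i mod length vs)}) [0..<length vs]) \<subseteq># E"
proof -
  define path where "path = (\<lambda>ps. ps \<noteq> [] \<and> distinct ps \<and> set ps \<subseteq> B \<and> (\<forall>i. Suc i < length ps \<longrightarrow> 0 < edge_mult E (ps ! i) (ps ! Suc i)))"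
  obtain b where "b \<in> B" using ne by auto
  then have pb: "path [b]" by (simp add: path_def)
  have "\<forall>ps. path ps \<longrightarrow> length ps < Suc (card B)"
    using card_mono[OF fB] by (auto simp: path_def less_Suc_eq_le simp flip: distinct_card)
  then obtain ps where pps: "path ps" and max: "\<And>qs. path qs \<Longrightarrow> length qs \<le> length ps"
    using ex_has_greatest_nat[of path "[b]" length, OF pb] by blast
  note ps = pps[unfolded path_def]
  obtain x xs where xs: "ps = x # xs" using ps by (cases ps) auto
  have xB: "x \<in> B" using ps xs by auto
  have nb: "z \<in> set xs" if z: "z \<in> B" "0 < edge_mult E x z" for z
  proof (rule ccontr)
    assume zx: "z \<notin> set xs"
    have zx': "z \<noteq> x" using z edge_mult_pos by metis
    have zm: "0 < edge_mult E z x" using z mult_fun_edge_mult[of E] by (simp add: mult_fun_def)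
    have "0 < edge_mult E ((z # ps) ! i) ((z # ps) ! Suc i)" if "Suc i < length (z # ps)" for i
      using ps zm that xs by (cases i) auto
    then have "path (z # ps)" using ps xs zx zx' z(1) by (simp add: path_def)
    then show False using max[of "z # ps"] by simp
  qed
  have "0 < degree (edge_mult E) x B" using deg[OF xB] by simp
  then obtain z0 where "z0 \<in> B" "0 < edge_mult E x z0" using degree_pos by metis
  then have "xs \<noteq> []" using nb by auto
  then obtain y ys where ys: "xs = y # ys" by (cases xs) auto
  have yB: "y \<in> B" and xy: "x \<noteq> y" using ps xs ys by auto
  show ?thesis
  \<comment> \<open>A doubled edge to the next vertex gives a cycle of length two. It is treated
    apart because its two edges are the same set, whereas longer cycles have distinct edges and
    inclusion as sets suffices.\<close>
  proof (cases "2 \<le> edge_mult E x y")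
    case True
    then have "2 \<le> count E {x, y}" using xy by (simp add: edge_mult_def)
    then have "{#{x, y}, {x, y}#} \<subseteq># E" by (intro mset_subset_eqI) auto
    then have "mset (map (\<lambda>i. {[x, y] ! i, [x, y] ! (Suc i mod length [x, y])}) [0..<length [x, y]]) \<subseteq># E"
      by (simp add: insert_commute)
    then show ?thesis using xB yB xy by (intro exI[of _ "[x, y]"]) auto
  next
    case False
    then have "0 < degree (edge_mult E) x (B - {y})" using deg[OF xB] degree_remove[OF fB yB, of "edge_mult E" x] by simp
    then obtain z where z: "z \<in> B - {y}" "0 < edge_mult E x z" using degree_pos by metis
    then have "z \<in> set ys" using nb[of z] ys by auto
    then obtain i where i: "i < length ys" "ys ! i = z" by (auto simp: in_set_conv_nth)
    \<comment> \<open>\<open>ps\<close> is \<open>x # y # ys\<close>, so \<open>z = ys ! i\<close>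
      has index \<open>i + 2\<close> and closes the prefix of length \<open>i + 3\<close>.\<close>
    define vs where "vs = take (i + 3) ps"
    have lvs: "length vs = i + 3" using i xs ys by (simp add: vs_def)
    have dvs: "distinct vs" "set vs \<subseteq> B" using ps set_take_subset[of "i + 3" ps] by (auto simp: vs_def)
    have nth: "vs ! j = ps ! j" if "j < i + 3" for j using that by (simp add: vs_def)
    have inj: "vs ! j = vs ! l \<longleftrightarrow> j = l" if "j < i + 3" "l < i + 3" for j l
      using that dvs lvs by (simp add: nth_eq_iff_index_eq)
    let ?e = "\<lambda>j. {vs ! j, vs ! (Suc j mod length vs)}"
    have S: "Suc j mod length vs = (if j = i + 2 then 0 else Suc j)" if "j < i + 3" for j
    proof (cases "j = i + 2")
      case True
      then have "Suc j = length vs" using lvs by simp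
      then show ?thesis using True by simp
    next
      case False
      then have "Suc j < length vs" using lvs that by simp
      then show ?thesis using False by simp
    qed
    have "?e j \<in># E" if j: "j < length vs" for j
    proof (cases "j = i + 2")
      case True
      have "vs ! (i + 2) = z" "vs ! 0 = x" using nth xs ys i by simp_all
      then have "?e j = {x, z}" using True S[of j] lvs by (simp add: insert_commute)
      then show ?thesis using z edge_mult_pos by metis
    next
      case False
      then have "?e j = {ps ! j, ps ! Suc j}" using j lvs S[of j] nth by simp
      moreover have "0 < edge_mult E (ps ! j) (ps ! Suc j)" using ps False j lvs i xs ys by auto
      ultimately show ?thesis using edge_mult_pos by metis
    qed
    moreover have "inj_on ?e {0..<length vs}"
    proof (rule inj_onI)
      fix j l assume jl: "j \<in> {0..<length vs}" "l \<in> {0..<length vs}" "?e j = ?e l"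
      then have jl': "j < i + 3" "l < i + 3" using lvs by auto
      then have "(j = l \<and> Suc j mod length vs = Suc l mod length vs) \<or>
          (j = Suc l mod length vs \<and> Suc j mod length vs = l)"
        using jl(3) inj S lvs by (auto simp: doubleton_eq_iff split: if_splits)
      then show "j = l" using S[OF jl'(1)] S[OF jl'(2)] by (auto split: if_splits)
    qed
    ultimately have "mset (map ?e [0..<length vs]) \<subseteq># E"
      by (intro distinct_mset_subset) (auto simp: distinct_map)
    then show ?thesis using dvs lvs by (intro exI[of _ vs]) auto
  qed
qed

text \<open>Deleting a vertex of degree at most one keeps at least as many edges as vertices, so
  minimum degree two is eventually reached.\<close>

lemma many_edges_cycle:
  assumes "finite B" "B \<noteq> {}" "card B \<le> edge_count (edge_mult E) B"
  shows "\<exists>vs. 2 \<le> length vs \<and> distinct vs \<and> set vs \<subseteq> B \<and>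
     mset (map (\<lambda>i. {vs ! i, vs ! (Suc i mod length vs)}) [0..<length vs]) \<subseteq># E"
  using assms
proof (induction "card B" arbitrary: B rule: less_induct)
  case less
  show ?case
  proof (cases "\<forall>x\<in>B. 2 \<le> degree (edge_mult E) x B")
    case True
    then show ?thesis using min_degree_cycle[OF less.prems(1,2)] by blast
  next
    case False
    then obtain x where x: "x \<in> B" "degree (edge_mult E) x B \<le> 1" by auto
    let ?B = "B - {x}"
    have f: "finite ?B" using less.prems by simp
    have B: "B = insert x ?B" using x by auto
    have "edge_count (edge_mult E) B = edge_count (edge_mult E) ?B + degree (edge_mult E) x ?B"
      using edge_count_insert[OF mult_fun_edge_mult f, of x E] B by simp
    moreover have "degree (edge_mult E) x ?B \<le> degree (edge_mult E) x B" using less.prems(1) by (intro degree_mono) auto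
    moreover have cB: "card B = Suc (card ?B)" using less.prems(1) x by (metis card.remove)
    ultimately have le: "card ?B \<le> edge_count (edge_mult E) ?B" using less.prems(3) x(2) by linarith
    have "?B \<noteq> {}"
    proof
      assume "?B = {}"
      then have "B = {x}" using x by auto
      then show False using less.prems(3) mult_fun_edge_mult[of E] by simp
    qed
    then obtain vs where "2 \<le> length vs \<and> distinct vs \<and> set vs \<subseteq> ?B \<and>
       mset (map (\<lambda>i. {vs ! i, vs ! (Suc i mod length vs)}) [0..<length vs]) \<subseteq># E"
      using less.hyps[of ?B] cB f le by auto
    then show ?thesis by auto
  qed
qed

lemma forest_acyclic_on:
  assumes G: "multigraph G" and F: "F \<subseteq> verts G" and fo: "forest (induced G F)"
  shows "acyclic_on (edge_mult (edges G)) F"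
  unfolding acyclic_on_def
proof (intro allI impI, rule ccontr)
  fix B assume B: "B \<subseteq> F" "B \<noteq> {}" "\<not> edge_count (edge_mult (edges G)) B < card B"
  have fB: "finite B" using B(1) F by (intro multigraph_finite[OF G]) auto
  obtain vs where vs: "2 \<le> length vs" "distinct vs" "set vs \<subseteq> B"
     "mset (map (\<lambda>i. {vs ! i, vs ! (Suc i mod length vs)}) [0..<length vs]) \<subseteq># edges (induced G F)"
    using many_edges_cycle[OF fB B(2), of "edges (induced G F)"] B(3) induced_edge_count[OF G B(1) fB] by auto
  have "is_cycle (induced G F) vs"
    using vs B(1) F by (auto simp: is_cycle_def induced_def[of G F])
  then show False using fo by (auto simp: forest_def)
qed

text \<open>A set B with \<open>card B - 1\<close> edges in a forest lies in one component:
  otherwise it splits into two nonempty acyclic parts with no edges between them and has at most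
  \<open>card B - 2\<close>. Its edges are then among those of the component.\<close>

lemma DF_colorable_wcolorable:
  assumes G: "multigraph G" and c: "DF_colorable D G"
  shows "wcolorable D (edge_mult (edges G)) (\<lambda>_. 0) (verts G)"
proof -
  obtain M F where MF: "M \<union> F = verts G" "M \<inter> F = {}" "forest (induced G M)" "forest (induced G F)"
    and comp: "\<And>C. C \<in> components (induced G M) \<Longrightarrow> size (edges C) \<le> D"
    using c by (auto simp: DF_colorable_def DF_coloring_def)
  have sub: "M \<subseteq> verts G" "F \<subseteq> verts G" using MF by auto
  let ?m = "edge_mult (edges G)" and ?H = "induced G M"
  have H: "multigraph ?H" by (rule multigraph_induced[OF G])
  have FM: "acyclic_on ?m M" and FF: "acyclic_on ?m F" using forest_acyclic_on[OF G] sub MF by auto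
  have "bounded_on D ?m (\<lambda>_. 0) M"
    unfolding bounded_on_def
  proof (intro allI impI conjI)
    fix B assume B: "B \<subseteq> M" "B \<noteq> {}"
    show "edge_count ?m B < card B" using acyclic_on_D[OF FM B] .
    assume tree: "Suc (edge_count ?m B) = card B"
    obtain v where v: "v \<in> B" using B(2) by auto
    have vH: "v \<in> verts ?H" using v B sub by (auto simp: induced_def)
    let ?R = "reach ?H v"
    have R: "?R \<subseteq> M" using reach_verts[OF H vH] by (auto simp: induced_def)
    have fM: "finite M" using multigraph_finite[OF G sub(1)] .
    have fR: "finite ?R" and fB: "finite B" using R B(1) fM finite_subset by blast+
    have BR: "B \<subseteq> ?R"
    proof (rule ccontr)
      assume "\<not> B \<subseteq> ?R"
      then have ne: "B - ?R \<noteq> {}" by auto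
      have ne': "B \<inter> ?R \<noteq> {}" using v by auto
      have "?m x z = 0" if "x \<in> B \<inter> ?R" "z \<in> B - ?R" for x z
      proof (rule ccontr)
        assume "?m x z \<noteq> 0"
        then have "{x, z} \<in># edges G" using edge_mult_pos[of "edges G" x z] by simp
        then have "(x, z) \<in> adjacency ?H" using that B by (auto simp: adjacency_def induced_def)
        then show False using that by (auto intro: rtrancl_into_rtrancl)
      qed
      then have "(\<Sum>x\<in>B \<inter> ?R. degree ?m x (B - ?R)) = 0" unfolding degree_def by (intro sum.neutral ballI) blast
      moreover have "edge_count ?m (B \<inter> ?R \<union> (B - ?R)) = edge_count ?m (B \<inter> ?R) + edge_count ?m (B - ?R) + (\<Sum>x\<in>B \<inter> ?R. degree ?m x (B - ?R))"
        using fB by (intro edge_count_Un[OF mult_fun_edge_mult]) auto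
      moreover have "B \<inter> ?R \<union> (B - ?R) = B" by auto
      moreover have "edge_count ?m (B \<inter> ?R) < card (B \<inter> ?R)" using B ne' by (intro acyclic_on_D[OF FM]) auto
      moreover have "edge_count ?m (B - ?R) < card (B - ?R)" using B ne by (intro acyclic_on_D[OF FM]) auto
      moreover have "card (B \<inter> ?R) + card (B - ?R) = card B"
        using fB by (subst card_Un_disjoint[symmetric]) (auto intro: arg_cong[where f = card])
      ultimately show False using tree by simp
    qed
    have "edge_count ?m B \<le> edge_count ?m ?R" by (rule edge_count_mono[OF mult_fun_edge_mult fR BR])
    also have "\<dots> = edge_count (edge_mult (edges ?H)) ?R" using induced_edge_count[OF G R fR] by simp
    also have "\<dots> = size (edges (induced ?H ?R))"
      using H fR by (subst edge_count_edge_mult) (auto simp: induced_def[of ?H] multigraph_def)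
    also have "\<dots> \<le> D" using vH by (intro comp) (auto simp: components_def)
    finally show "edge_count ?m B + sum (\<lambda>_. 0) B \<le> D" by simp
  qed
  then show ?thesis using MF FF by (intro wcolorableI[of M F])
qed

lemma critical_wcolorable:
  assumes c: "DF_critical D G"
  shows "\<not> wcolorable D (edge_mult (edges G)) (\<lambda>_. 0) (verts G)"
    "S \<subset> verts G \<Longrightarrow> wcolorable D (edge_mult (edges G)) (\<lambda>_. 0) S"
proof -
  have G: "multigraph G" using c by (simp add: DF_critical_def)
  show "\<not> wcolorable D (edge_mult (edges G)) (\<lambda>_. 0) (verts G)"
    using wcolorable_DF_colorable[OF G] c by (auto simp: DF_critical_def)
  assume S: "S \<subset> verts G"
  let ?H = "induced G S"
  have vS: "verts ?H = S" using S by (auto simp: induced_def)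
  then have "?H \<noteq> G" using S by auto
  moreover have "subgraph ?H G"
    using multigraph_induced[OF G, of S] by (auto simp: subgraph_def induced_def)
  ultimately have "proper_subgraph ?H G" by (simp add: proper_subgraph_def)
  with vS have "wcolorable D (edge_mult (edges ?H)) (\<lambda>_. 0) S"
    using DF_colorable_wcolorable[OF multigraph_induced[OF G, of S], of D] c by (auto simp: DF_critical_def)
  then obtain M F where MF: "M \<union> F = S" "M \<inter> F = {}" "bounded_on D (edge_mult (edges ?H)) (\<lambda>_. 0) M" "acyclic_on (edge_mult (edges ?H)) F"
    unfolding wcolorable_def by blast
  have "edge_count (edge_mult (edges ?H)) B = edge_count (edge_mult (edges G)) B" if "B \<subseteq> S" for B
    using that S by (intro induced_edge_count[OF G] multigraph_finite[OF G]) auto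
  then have "edge_count (edge_mult (edges ?H)) B = edge_count (edge_mult (edges G)) B" if "B \<subseteq> M \<or> B \<subseteq> F" for B
    using that MF(1) by auto
  then have "bounded_on D (edge_mult (edges G)) (\<lambda>_. 0) M" "acyclic_on (edge_mult (edges G)) F"
    using MF(3,4) by (simp_all add: bounded_on_def acyclic_on_def)
  then show "wcolorable D (edge_mult (edges G)) (\<lambda>_. 0) S" using MF(1,2) by (intro wcolorableI[of M F])
qed

theorem theorem1p6:
  shows "(\<forall>(D::nat) (G::'a mgraph).
            odd D \<and> D \<ge> 1 \<and> DF_critical D G \<and> card (verts G) \<ge> 3 \<longrightarrow>
            real (size (edges G))
              \<ge> ((4 * real D + 3) * real (card (verts G)) + 2) / (2 * (real D + 1))) \<and>
         (\<forall>(D::nat) (G::'a mgraph).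
            even D \<and> D \<ge> 2 \<and> DF_critical D G \<and> card (verts G) \<ge> 3 \<longrightarrow>
            real (size (edges G))
              \<ge> ((4 * real D + 1) * real (card (verts G)) + 2) / (2 * real D + 1))"
proof (intro conjI allI impI; elim conjE)
  have ecV: "edge_count (edge_mult (edges G)) (verts G) = size (edges G)" and fV: "finite (verts G)"
    if "DF_critical D G" for D and G :: "'a mgraph"
  proof -
    have "filter_mset (\<lambda>e. e \<subseteq> verts G) (edges G) = edges G"
      using that by (auto simp: DF_critical_def multigraph_def filter_mset_eq_conv)
    then show "edge_count (edge_mult (edges G)) (verts G) = size (edges G)" "finite (verts G)"
      using that by (auto simp: DF_critical_def multigraph_def edge_count_edge_mult)
  qed
  fix D and G :: "'a mgraph"
  {
    assume "odd D" and c: "DF_critical D G"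
    then obtain q where D: "D = 2 * q + 1" by (auto elim: oddE)
    \<comment> \<open>All weights are 0, so each vertex has potential \<open>2 * k - 1\<close>, and
      \<open>-2\<close> as an upper bound reads \<open>(2 * k - 1) * n + 2 <= k * e\<close> for n
      vertices and e edges. Here \<open>k = 2 * D + 2\<close>, in the even case
      \<open>k = 2 * D + 1\<close>.\<close>
    have "pot (pot_odd q) (4 * int q + 4) (edge_mult (edges G)) (\<lambda>_. 0) (verts G) \<le> - 2"
      using critical_odd[OF fV[OF c] mult_fun_edge_mult] critical_wcolorable[OF c] D by blast
    then have "int (card (verts G)) * (8 * int q + 7) + 2 \<le> (4 * int q + 4) * int (size (edges G))"
      by (simp add: pot_def pot_odd_def ecV[OF c])
    then have "real_of_int (int (card (verts G)) * (8 * int q + 7) + 2) \<le> real_of_int ((4 * int q + 4) * int (size (edges G)))"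
      by (simp only: of_int_le_iff)
    then show "((4 * real D + 3) * real (card (verts G)) + 2) / (2 * (real D + 1)) \<le> real (size (edges G))"
      by (simp add: D divide_le_eq algebra_simps)
  next
    assume "even D" "D \<ge> 2" and c: "DF_critical D G"
    then obtain g where D: "D = 2 * g" "1 \<le> g" by auto
    have "pot (pot_even g) (4 * int g + 1) (edge_mult (edges G)) (\<lambda>_. 0) (verts G) \<le> - 2"
      using critical_even[OF D(2) fV[OF c] mult_fun_edge_mult] critical_wcolorable[OF c] D(1) by blast
    then have "int (card (verts G)) * (8 * int g + 1) + 2 \<le> (4 * int g + 1) * int (size (edges G))"
      by (simp add: pot_def pot_even_def ecV[OF c])
    then have "real_of_int (int (card (verts G)) * (8 * int g + 1) + 2) \<le> real_of_int ((4 * int g + 1) * int (size (edges G)))"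
      by (simp only: of_int_le_iff)
    then show "((4 * real D + 1) * real (card (verts G)) + 2) / (2 * real D + 1) \<le> real (size (edges G))"
      by (simp add: D divide_le_eq algebra_simps)
  }
qed

end
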